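(* Let $n\ge 1$ and let $V_{I_2(2n+1)}$ be the free $\Lambda$-module with basis $v_0,\dots,v_{2n}$ carrying the generalized Lawrence-Krammer representation of the Artin group $A_{I_2(2n+1)}$. Define $\alpha_{i,j}\in\Lambda$ by $p_i(v_j)=\alpha_{i,j}v_i$, set $(v_i,v_j)=\overline{\alpha_{i,j}}$ for $0\le i,j\le 2n$, and extend this to a Hermitian form $(\cdot,\cdot):V_{I_2(2n+1)}\times V_{I_2(2n+1)}\to\Lambda$. Then this form is $A_{I_2(2n+1)}$-invariant, i.e. $(gv,gw)=(v,w)$ for all $g\in A_{I_2(2n+1)}$ and $v,w\in V_{I_2(2n+1)}$. Furthermore, any $A_{I_2(2n+1)}$-invariant Hermitian form on $V_{I_2(2n+1)}$ is a constant (scalar) multiple of this one.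
   Context: Notation: $\Lambda=\mathbb{Q}[m^{\pm1},l^{\pm1}]$, with conjugation $\overline{f(m,l)}=f(-m,l^{-1})$, and $\tau=\frac{l-l^{-1}}{m}+1$. $[AB\ldots]_N$ is the alternating word of length $N$ in $A,B$ beginning with $A$; $[\ldots AB]_N$ is the alternating word of length $N$ ending with $B$; words of length $0$ are the identity. A function $(\cdot,\cdot):V\times V\to\Lambda$ (biadditive) is called Hermitian if $(w,v)=\overline{(v,w)}$ and $(fv,gw)=f\bar g\,(v,w)$ for all $v,w\in V$, $f,g\in\Lambda$. $A_{I_2(2n+1)}=\langle\sigma_0,\sigma_1\mid[\sigma_0\sigma_1\ldots]_{2n+1}=[\sigma_1\sigma_0\ldots]_{2n+1}\rangle$; the generalized Lawrence-Krammer representation sends $\sigma_i$ to the operator $X_i$ on $V_{I_2(2n+1)}$, where $X_0v_0=lv_0$; $X_0v_{2k}=mv_0-mv_{2k}+v_{2k-1}$ for $1\le k\le n$; $X_0v_{2k+1}=v_{2k+2}$ for $0\le k\le n-1$; $X_1v_{2k}=v_{2k+1}$ for $0\le k\le n-1$; $X_1v_{2n}=lv_{2n}$; $X_1v_{2k+1}=v_{2k}-mv_{2k+1}+ml\,v_{2n}$ for $0\le k\le n-1$. Also $E_0v_0=\tau v_0$; $E_0v_{2k}=v_0$ for $1\le k\le n$; $E_0v_{2k+1}=l^{-1}v_0$ for $0\le k\le n-1$. For $0\le i\le 2n$, $p_i=[\ldots X_0X_1]_i\,E_0\,[X_1^{-1}X_0^{-1}\ldots]_i$; its image lies in $\Lambda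 v_i$, so $\alpha_{i,j}$ is defined by $p_i(v_j)=\alpha_{i,j}v_i$. *)

theory Defs
  imports
    "HOL-Algebra.Group"
    "HOL-Library.Poly_Mapping"
    "HOL-Library.Product_Plus"
    "Jordan_Normal_Form.Matrix"
begin

section \<open>The ring of Laurent polynomials in m and l over the rationals\<close>

(* Q[m^{+-1}, l^{+-1}] as the group ring of Z x Z (convolution product):
   the coefficient of m^a l^b is the value at (a, b). *)
type_synonym laurent = "(int \<times> int) \<Rightarrow>\<^sub>0 rat"

definition lmono :: "int \<Rightarrow> int \<Rightarrow> laurent" where
  "lmono a b = Poly_Mapping.single (a, b) 1"

abbreviation mm :: laurent where "mm \<equiv> lmono 1 0"
abbreviation mm_inv :: laurent where "mm_inv \<equiv> lmono (-1) 0"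
abbreviation ll :: laurent where "ll \<equiv> lmono 0 1"
abbreviation ll_inv :: laurent where "ll_inv \<equiv> lmono 0 (-1)"

definition tau :: laurent where
  "tau = (ll - ll_inv) * mm_inv + 1"

(* f(m, l) |-> f(-m, l^{-1}): a term c m^a l^b is sent to (-1)^a c m^a l^{-b}. *)
definition bar_conj :: "laurent \<Rightarrow> laurent" where
  "bar_conj f = (\<Sum>(a, b)\<in>Poly_Mapping.keys f.
     Poly_Mapping.single (a, - b)
       (if even a then Poly_Mapping.lookup f (a, b) else - Poly_Mapping.lookup f (a, b)))"

section \<open>Alternating words\<close>

fun alt_begin :: "'a \<Rightarrow> 'a \<Rightarrow> nat \<Rightarrow> 'a list" where
  "alt_begin a b 0 = []"
| "alt_begin a b (Suc k) = a # alt_begin b a k"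

(* The alternating word of length k in a, b that ends with b. *)
definition alt_end :: "'a \<Rightarrow> 'a \<Rightarrow> nat \<Rightarrow> 'a list" where
  "alt_end a b k = rev (alt_begin b a k)"

section \<open>Groups given by generators and relations\<close>

(* A letter (s, True) stands for the generator s, and (s, False) for its inverse. *)
type_synonym 's word = "('s \<times> bool) list"

inductive pres_eq :: "('s word \<times> 's word) set \<Rightarrow> 's word \<Rightarrow> 's word \<Rightarrow> bool"
  for R where
  relation: "(u, v) \<in> R \<Longrightarrow> pres_eq R u v"
| cancel: "pres_eq R [(s, e), (s, \<not> e)] []"
| refl: "pres_eq R u u"
| sym: "pres_eq R u v \<Longrightarrow> pres_eq R v u"
| trans: "pres_eq R u v \<Longrightarrow> pres_eq R v w \<Longrightarrow> pres_eq R u w"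
| append: "pres_eq R u u' \<Longrightarrow> pres_eq R v v' \<Longrightarrow> pres_eq R (u @ v) (u' @ v')"

definition word_class :: "('s word \<times> 's word) set \<Rightarrow> 's word \<Rightarrow> 's word set" where
  "word_class R u = {v. pres_eq R u v}"

definition presented_group :: "('s word \<times> 's word) set \<Rightarrow> 's word set monoid" where
  "presented_group R =
     \<lparr>carrier = UNIV // {(u, v). pres_eq R u v},
      monoid.mult = (\<lambda>C D. \<Union>u\<in>C. \<Union>v\<in>D. word_class R (u @ v)),
      one = word_class R []\<rparr>"

section \<open>The Artin group of type I_2(2n+1)\<close>

datatype artin_gen = Sigma0 | Sigma1

definition artin_I2 :: "nat \<Rightarrow> artin_gen word set monoid" where
  "artin_I2 n = presented_group
     {(alt_begin (Sigma0, True) (Sigma1, True) (2*n+1),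
       alt_begin (Sigma1, True) (Sigma0, True) (2*n+1))}"

section \<open>The generalized Lawrence-Krammer representation\<close>

abbreviation LK_space :: "nat \<Rightarrow> laurent vec set" where
  "LK_space n \<equiv> carrier_vec (2*n+1)"

definition bv :: "nat \<Rightarrow> nat \<Rightarrow> laurent vec" where
  "bv n i = unit_vec (2*n+1) i"

(* The operator on LK_space n that sends the basis vector bv n j to f j. *)
definition op_of :: "nat \<Rightarrow> (nat \<Rightarrow> laurent vec) \<Rightarrow> laurent mat" where
  "op_of n f = mat_of_cols (2*n+1) (map f [0..<2*n+1])"

definition X0 :: "nat \<Rightarrow> laurent mat" where
  "X0 n = op_of n (\<lambda>j.
     if j = 0 then ll \<cdot>\<^sub>v bv n 0
     else if even j then mm \<cdot>\<^sub>v bv n 0 - mm \<cdot>\<^sub>v bv n j + bv n (j - 1)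
     else bv n (j + 1))"

definition X1 :: "nat \<Rightarrow> laurent mat" where
  "X1 n = op_of n (\<lambda>j.
     if j = 2*n then ll \<cdot>\<^sub>v bv n (2*n)
     else if even j then bv n (j + 1)
     else bv n (j - 1) - mm \<cdot>\<^sub>v bv n j + (mm * ll) \<cdot>\<^sub>v bv n (2*n))"

definition E0 :: "nat \<Rightarrow> laurent mat" where
  "E0 n = op_of n (\<lambda>j.
     if j = 0 then tau \<cdot>\<^sub>v bv n 0
     else if even j then bv n 0
     else ll_inv \<cdot>\<^sub>v bv n 0)"

definition op_inv :: "nat \<Rightarrow> laurent mat \<Rightarrow> laurent mat" where
  "op_inv n A = m_inv (ring_mat TYPE(laurent) (2*n+1) ()) A"

definition op_prod :: "nat \<Rightarrow> laurent mat list \<Rightarrow> laurent mat" where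
  "op_prod n As = foldr (*) As (1\<^sub>m (2*n+1))"

fun gen_op :: "nat \<Rightarrow> artin_gen \<Rightarrow> laurent mat" where
  "gen_op n Sigma0 = X0 n"
| "gen_op n Sigma1 = X1 n"

definition word_op :: "nat \<Rightarrow> artin_gen word \<Rightarrow> laurent mat" where
  "word_op n w = op_prod n
     (map (\<lambda>(s, e). if e then gen_op n s else op_inv n (gen_op n s)) w)"

(* The homomorphism induced on the quotient: X_0 and X_1 are invertible and satisfy the
   braid relation of length 2n+1, so all words of a class act by the same operator. *)
definition LK_rep :: "nat \<Rightarrow> artin_gen word set \<Rightarrow> laurent mat" where
  "LK_rep n g = the_elem (word_op n ` g)"

section \<open>Hermitian forms\<close>

definition hermitian_form :: "nat \<Rightarrow> (laurent vec \<Rightarrow> laurent vec \<Rightarrow> laurent) \<Rightarrow> bool" where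
  "hermitian_form n h \<longleftrightarrow>
     (\<forall>u\<in>LK_space n. \<forall>v\<in>LK_space n. \<forall>w\<in>LK_space n.
        h (u + v) w = h u w + h v w \<and> h u (v + w) = h u v + h u w) \<and>
     (\<forall>v\<in>LK_space n. \<forall>w\<in>LK_space n. h w v = bar_conj (h v w)) \<and>
     (\<forall>f g. \<forall>v\<in>LK_space n. \<forall>w\<in>LK_space n.
        h (f \<cdot>\<^sub>v v) (g \<cdot>\<^sub>v w) = f * bar_conj g * h v w)"

definition artin_invariant :: "nat \<Rightarrow> (laurent vec \<Rightarrow> laurent vec \<Rightarrow> laurent) \<Rightarrow> bool" where
  "artin_invariant n h \<longleftrightarrow>
     (\<forall>g\<in>carrier (artin_I2 n). \<forall>v\<in>LK_space n. \<forall>w\<in>LK_space n.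
        h (LK_rep n g *\<^sub>v v) (LK_rep n g *\<^sub>v w) = h v w)"

definition p_op :: "nat \<Rightarrow> nat \<Rightarrow> laurent mat" where
  "p_op n i =
     op_prod n (alt_end (X0 n) (X1 n) i) * E0 n *
     op_prod n (alt_begin (op_inv n (X1 n)) (op_inv n (X0 n)) i)"

(* Well defined for i, j <= 2n: the image of p_op n i lies in the span of bv n i. *)
definition alpha :: "nat \<Rightarrow> nat \<Rightarrow> nat \<Rightarrow> laurent" where
  "alpha n i j = (THE a. p_op n i *\<^sub>v bv n j = a \<cdot>\<^sub>v bv n i)"

(* The sesquilinear extension of (v_i, v_j) = bar_conj (alpha_{i,j}); that it is Hermitian
   is a property of the coefficients and is not built into the definition. *)
definition LK_form :: "nat \<Rightarrow> laurent vec \<Rightarrow> laurent vec \<Rightarrow> laurent" where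
  "LK_form n v w = (\<Sum>i\<le>2*n. \<Sum>j\<le>2*n. v $ i * bar_conj (w $ j) * bar_conj (alpha n i j))"

end

theory Submission
  imports Defs
begin

text \<open>
  Everything rests on a closed form for the coefficients: \<open>\<alpha>\<^sub>i\<^sub>j\<close> is \<open>\<tau>\<close> on the diagonal, \<open>1\<close> when
  \<open>i\<close> and \<open>j\<close> are distinct of equal parity, and otherwise \<open>l\<^sup>-\<^sup>1\<close> above and \<open>l\<close> below the diagonal
  (\<open>gram\<close>, \<open>alpha_eq_gram\<close>). Conjugation fixes \<open>\<tau>\<close> and exchanges \<open>l\<close> with \<open>l\<^sup>-\<^sup>1\<close>, so the
  matrix is Hermitian. The closed form is found by viewing \<open>E\<^sub>0\<close> as the rank-one operator
  \<open>x \<mapsto> a\<^sub>0(x) v\<^sub>0\<close>: the alternating words carry \<open>v\<^sub>0\<close> up the ladder \<open>v\<^sub>0, v\<^sub>1, \<dots>, v\<^sub>2\<^sub>n\<close>, their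
  inverses carry the row \<open>a\<^sub>0\<close> up a ladder of rows \<open>a\<^sub>0, a\<^sub>1, \<dots>, a\<^sub>2\<^sub>n\<close>, and \<open>p\<^sub>i\<close> is
  \<open>x \<mapsto> a\<^sub>i(x) v\<^sub>i\<close>, where \<open>a\<^sub>i\<close> is row \<open>i\<close> of the matrix.

  Invariance under a generator compares its action on the basis vectors with its action on the
  rows \<open>a\<^sub>i\<close>. The two actions have the same shape, and \<open>m\<close> being conjugate to \<open>-m\<close> makes the
  terms with \<open>m\<close> cancel (\<open>LK_form_X0\<close>, \<open>LK_form_X1\<close>).

  An element of the group is a class of words, and the operator of a class makes sense only if the
  generators satisfy the braid relation. If they do, then the word of length \<open>2n+1\<close> exchanges
  \<open>X\<^sub>0\<close> and \<open>X\<^sub>1\<close> under conjugation and sends \<open>v\<^sub>0\<close> to \<open>l v\<^sub>2\<^sub>n\<close>, which determines it. The operator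
  \<open>flip\<close> written down from this prescription does intertwine the generators, by the skein relation
  \<open>X - X\<^sup>-\<^sup>1 + m = m E\<close>, where \<open>E\<close> has rank one. Each of the two words of length \<open>2n+1\<close> agrees with
  \<open>flip\<close> on the basis vectors of one parity, and the intertwining spreads this to the others
  (\<open>word0_eq_flip\<close>, \<open>word1_eq_flip\<close>).

  For uniqueness, let \<open>h\<close> be an invariant form. As \<open>v\<^sub>0\<close> is an eigenvector of \<open>X\<^sub>0\<close>, the conjugate
  of \<open>h(v\<^sub>0, -)\<close> is an eigenfunctional of \<open>X\<^sub>0\<close> for the eigenvalue \<open>l\<close>, and these are multiples of
  \<open>a\<^sub>0\<close> because \<open>\<tau>\<close> can be cancelled (\<open>X0_eigenfunctional\<close>). Going up the ladder by
  invariance gives \<open>h(v\<^sub>i, -)\<close> for every \<open>i\<close>.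
\<close>

section \<open>Laurent polynomials\<close>

lemma lmono_mult [simp]: "lmono a b * lmono c d = lmono (a + c) (b + d)"
  by (simp add: lmono_def mult_single)

lemma lmono_zero [simp]: "lmono 0 0 = 1"
  by (simp add: lmono_def zero_prod_def[symmetric])

lemma lmono_mult_left [simp]: "lmono a b * (lmono c d * f) = lmono (a + c) (b + d) * f"
  by (simp add: mult.assoc[symmetric])

lemma poly_mapping_induct [case_names zero single_add]:
  fixes f :: "'a \<Rightarrow>\<^sub>0 'b :: monoid_add"
  assumes "P 0" and step: "\<And>k c f. P f \<Longrightarrow> P (Poly_Mapping.single k c + f)"
  shows "P f"
proof (induction f rule: update_induct)
  case const
  then show ?case by fact
next
  case (update f k c)
  have "Poly_Mapping.update k c f = Poly_Mapping.single k c + f"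
    using update(1) by (intro poly_mapping_eqI)
      (auto simp: lookup_update lookup_add lookup_single when_def in_keys_iff)
  with step[OF update(3)] show ?case by simp
qed

lemma lookup_lmono_mult:
  "Poly_Mapping.lookup (lmono a b * f) (x, y) = Poly_Mapping.lookup f (x - a, y - b)"
proof (induction f rule: poly_mapping_induct)
  case (single_add k c f)
  then show ?case
    by (cases k) (auto simp: algebra_simps lookup_add lmono_def mult_single lookup_single when_def)
qed simp

text \<open>Cancelling \<open>\<tau>\<close> is what makes eigenfunctionals of \<open>X\<^sub>0\<close> unique up to scalars. Multiply by \<open>ml\<close>,
  so that \<open>\<tau>\<close> becomes \<open>l\<^sup>2 - 1 + ml\<close>, and look at the highest power of \<open>m\<close> in \<open>f\<close>: only the
  term \<open>ml\<close> raises it, so nothing can cancel its coefficient.\<close>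
lemma tau_mult_eq_zeroD:
  assumes "tau * f = 0"
  shows "f = 0"
proof (rule ccontr)
  assume "f \<noteq> 0"
  then have ne: "fst ` Poly_Mapping.keys f \<noteq> {}" by simp
  define a where "a = Max (fst ` Poly_Mapping.keys f)"
  have "a \<in> fst ` Poly_Mapping.keys f" unfolding a_def by (intro Max_in ne) simp
  then obtain b where ab: "Poly_Mapping.lookup f (a, b) \<noteq> 0" by (auto simp: in_keys_iff)
  have top: "Poly_Mapping.lookup f (x, y) = 0" if "x > a" for x y
  proof (rule ccontr)
    assume "Poly_Mapping.lookup f (x, y) \<noteq> 0"
    then have "x \<in> fst ` Poly_Mapping.keys f" by (force simp: in_keys_iff)
    then have "x \<le> a" unfolding a_def by (intro Max_ge) auto
    with that show False by simp
  qed
  have "lmono 1 1 * (tau * f) = lmono 0 2 * f - lmono 0 0 * f + lmono 1 1 * f"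
    by (simp add: tau_def algebra_simps)
  then have "Poly_Mapping.lookup (lmono 0 2 * f - lmono 0 0 * f + lmono 1 1 * f) (a + 1, b + 1) = 0"
    using assms by simp
  then show False
    using ab by (simp only: lookup_add lookup_minus lookup_lmono_mult) (simp add: top)
qed

lemma lookup_bar_conj:
  "Poly_Mapping.lookup (bar_conj f) (a, b) =
     (if even a then Poly_Mapping.lookup f (a, - b) else - Poly_Mapping.lookup f (a, - b))"
proof -
  let ?g = "\<lambda>c d. if even c then Poly_Mapping.lookup f (c, d) else - Poly_Mapping.lookup f (c, d)"
  have "Poly_Mapping.lookup (bar_conj f) (a, b) =
      (\<Sum>p\<in>Poly_Mapping.keys f. ?g (fst p) (snd p) when (fst p, - snd p) = (a, b))"
    by (simp add: bar_conj_def lookup_sum case_prod_unfold lookup_single)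
  also have "\<dots> = (\<Sum>p\<in>Poly_Mapping.keys f. if p = (a, - b) then ?g a (- b) else 0)"
    by (intro sum.cong) (auto simp: when_def)
  finally show ?thesis
    by (auto simp: in_keys_iff sum.delta)
qed

lemma bar_conj_add [simp]: "bar_conj (f + g) = bar_conj f + bar_conj g"
  by (rule poly_mapping_eqI) (auto simp: lookup_bar_conj lookup_add)

lemma bar_conj_minus [simp]: "bar_conj (f - g) = bar_conj f - bar_conj g"
  by (rule poly_mapping_eqI) (auto simp: lookup_bar_conj lookup_minus)

lemma bar_conj_zero [simp]: "bar_conj 0 = 0"
  by (rule poly_mapping_eqI) (auto simp: lookup_bar_conj)

lemma bar_conj_bar_conj [simp]: "bar_conj (bar_conj f) = f"
  by (rule poly_mapping_eqI) (auto simp: lookup_bar_conj)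

lemma bar_conj_single:
  "bar_conj (Poly_Mapping.single (a, b) c) = Poly_Mapping.single (a, - b) (if even a then c else - c)"
proof (rule poly_mapping_eqI)
  fix k
  show "Poly_Mapping.lookup (bar_conj (Poly_Mapping.single (a, b) c)) k =
      Poly_Mapping.lookup (Poly_Mapping.single (a, - b) (if even a then c else - c)) k"
    by (cases k) (auto simp: lookup_bar_conj lookup_single when_def split: if_splits)
qed

lemma bar_conj_lmono: "bar_conj (lmono a b) = (if even a then lmono a (- b) else - lmono a (- b))"
  by (simp add: lmono_def bar_conj_single single_uminus)

lemma bar_conj_gens [simp]:
  "bar_conj 1 = 1" "bar_conj ll = ll_inv" "bar_conj ll_inv = ll"
  "bar_conj mm = - mm" "bar_conj mm_inv = - mm_inv"
  using bar_conj_lmono[of 0 0] by (simp_all add: bar_conj_lmono)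

lemma bar_conj_single_mult:
  "bar_conj (Poly_Mapping.single k c * g) = bar_conj (Poly_Mapping.single k c) * bar_conj g"
proof (induction g rule: poly_mapping_induct)
  case (single_add k' c' g)
  then show ?case
    by (cases k; cases k') (auto simp: distrib_left mult_single bar_conj_single)
qed simp

lemma bar_conj_mult [simp]: "bar_conj (f * g) = bar_conj f * bar_conj g"
proof (induction f rule: poly_mapping_induct)
  case (single_add k c f)
  then show ?case by (simp add: distrib_right bar_conj_single_mult)
qed simp

lemma bar_conj_sum: "bar_conj (sum f A) = (\<Sum>x\<in>A. bar_conj (f x))"
  by (induction A rule: infinite_finite_induct) auto

lemma bar_conj_tau [simp]: "bar_conj tau = tau"
  by (simp add: tau_def algebra_simps bar_conj_lmono)

section \<open>Linear algebra over a commutative ring\<close>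

lemma functional_expand:
  fixes f :: "'a :: comm_ring_1 vec \<Rightarrow> 'a"
  assumes add: "\<And>u v. u \<in> carrier_vec N \<Longrightarrow> v \<in> carrier_vec N \<Longrightarrow> f (u + v) = f u + f v"
    and smult: "\<And>c v. v \<in> carrier_vec N \<Longrightarrow> f (c \<cdot>\<^sub>v v) = c * f v"
    and x: "x \<in> carrier_vec N"
  shows "f x = (\<Sum>i<N. x $ i * f (unit_vec N i))"
proof -
  \<comment> \<open>The truncations of \<open>x\<close> to its first \<open>k\<close> coordinates allow an induction on \<open>k\<close>.\<close>
  define y where "y = (\<lambda>k. vec N (\<lambda>i. if i < k then x $ i else 0))"
  have y: "y k \<in> carrier_vec N" for k by (simp add: y_def)
  have "f (y k) = (\<Sum>i<k. x $ i * f (unit_vec N i))" if "k \<le> N" for k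
    using that
  proof (induction k)
    case 0
    have "y 0 = 0 \<cdot>\<^sub>v y 0" by (rule eq_vecI) (auto simp: y_def)
    then show ?case using smult[OF y, of 0 0] by simp
  next
    case (Suc k)
    have "y (Suc k) = y k + x $ k \<cdot>\<^sub>v unit_vec N k"
      using Suc.prems by (intro eq_vecI) (auto simp: y_def less_Suc_eq)
    with Suc show ?case by (simp add: add smult y)
  qed
  moreover have "y N = x" using x by (intro eq_vecI) (auto simp: y_def)
  ultimately show ?thesis by auto
qed

lemma functional_eqI:
  fixes f g :: "'a :: comm_ring_1 vec \<Rightarrow> 'a"
  assumes "\<And>u v. u \<in> carrier_vec N \<Longrightarrow> v \<in> carrier_vec N \<Longrightarrow> f (u + v) = f u + f v"
    and "\<And>c v. v \<in> carrier_vec N \<Longrightarrow> f (c \<cdot>\<^sub>v v) = c * f v"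
    and "\<And>u v. u \<in> carrier_vec N \<Longrightarrow> v \<in> carrier_vec N \<Longrightarrow> g (u + v) = g u + g v"
    and "\<And>c v. v \<in> carrier_vec N \<Longrightarrow> g (c \<cdot>\<^sub>v v) = c * g v"
    and "\<And>i. i < N \<Longrightarrow> f (unit_vec N i) = g (unit_vec N i)"
    and x: "x \<in> carrier_vec N"
  shows "f x = g x"
  using functional_expand[of N f, OF assms(1,2) x] functional_expand[of N g, OF assms(3,4) x] assms(5)
  by simp

lemma mult_mat_smult_vec:
  fixes A :: "'a :: comm_ring_1 mat"
  assumes "A \<in> carrier_mat nr nc" "v \<in> carrier_vec nc"
  shows "A *\<^sub>v (c \<cdot>\<^sub>v v) = c \<cdot>\<^sub>v (A *\<^sub>v v)"
  using assms by (intro eq_vecI) auto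

lemma mult_mat_unit_vec:
  fixes A :: "'a :: comm_ring_1 mat"
  assumes "A \<in> carrier_mat nr nc" "j < nc"
  shows "A *\<^sub>v unit_vec nc j = col A j"
  using assms by (intro eq_vecI) auto

lemma mat_eqI_unit_vec:
  fixes A B :: "'a :: comm_ring_1 mat"
  assumes "A \<in> carrier_mat nr nc" "B \<in> carrier_mat nr nc"
    and "\<And>j. j < nc \<Longrightarrow> A *\<^sub>v unit_vec nc j = B *\<^sub>v unit_vec nc j"
  shows "A = B"
  using assms by (intro mat_col_eqI) (auto simp: mult_mat_unit_vec[of _ nr nc])

definition rank_one :: "'a :: comm_ring_1 vec \<Rightarrow> 'a vec \<Rightarrow> 'a mat" where
  "rank_one u a = mat (dim_vec u) (dim_vec a) (\<lambda>(i, j). u $ i * a $ j)"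

lemma rank_one_carrier [simp]:
  "u \<in> carrier_vec nr \<Longrightarrow> a \<in> carrier_vec nc \<Longrightarrow> rank_one u a \<in> carrier_mat nr nc"
  by (auto simp: rank_one_def)

lemma rank_one_mult_vec:
  assumes "x \<in> carrier_vec (dim_vec a)"
  shows "rank_one u a *\<^sub>v x = (a \<bullet> x) \<cdot>\<^sub>v u"
  using assms
  by (intro eq_vecI) (auto simp: rank_one_def scalar_prod_def sum_distrib_right sum_distrib_left ac_simps)

section \<open>Alternating words and iteration\<close>

lemma alt_begin_Suc_snoc: "alt_begin a b (Suc k) = alt_begin a b k @ [if even k then a else b]"
  by (induction k arbitrary: a b) auto

lemma alt_end_Suc_Cons: "alt_end a b (Suc k) = (if even k then b else a) # alt_end a b k"
  unfolding alt_end_def alt_begin_Suc_snoc[of b a k] by simp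

lemma set_alt_begin: "set (alt_begin a b k) \<subseteq> {a, b}"
  by (induction k arbitrary: a b) auto

lemma map_alt_begin: "map f (alt_begin a b k) = alt_begin (f a) (f b) k"
  by (induction k arbitrary: a b) auto

lemma funpow_funpow_commute: "(f ^^ i) ((f ^^ j) x) = (f ^^ j) ((f ^^ i) x)"
  by (metis add.commute comp_apply funpow_add)

section \<open>The two generators on vectors and on rows\<close>

text \<open>The closed form of the coefficients \<open>\<alpha>\<^sub>i\<^sub>j\<close>.\<close>
definition gram :: "nat \<Rightarrow> nat \<Rightarrow> laurent" where
  "gram i j = (if i = j then tau else if even (i + j) then 1 else if i < j then ll_inv else ll)"

text \<open>The cases \<open>0\<close> and \<open>2k + 2\<close> are listed apart from \<open>2k\<close> because the case analysis for \<open>X\<^sub>0\<close>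
  below produces the indices in these forms.\<close>
lemma gram_simps:
  "gram 0 0 = tau" "gram 0 (Suc (2 * j)) = ll_inv" "gram 0 (Suc (Suc (2 * j))) = 1"
  "gram (Suc (2 * i)) 0 = ll" "gram (Suc (Suc (2 * i))) 0 = 1"
  "gram (2 * i) (2 * j) = (if i = j then tau else 1)"
  "gram (2 * i) (Suc (2 * j)) = (if i \<le> j then ll_inv else ll)"
  "gram (Suc (2 * i)) (2 * j) = (if i < j then ll_inv else ll)"
  "gram (Suc (2 * i)) (Suc (2 * j)) = (if i = j then tau else 1)"
  "gram (Suc (2 * i)) (Suc (Suc (2 * j))) = (if i \<le> j then ll_inv else ll)"
  "gram (Suc (Suc (2 * i))) (Suc (2 * j)) = (if i < j then ll_inv else ll)"
  "gram (Suc (Suc (2 * i))) (Suc (Suc (2 * j))) = (if i = j then tau else 1)"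
  by (auto simp: gram_def)

lemma gram_hermitian: "bar_conj (gram i j) = gram j i"
  by (auto simp: gram_def add.commute)

definition gram_row :: "nat \<Rightarrow> nat \<Rightarrow> laurent vec" where
  "gram_row n i = vec (2 * n + 1) (gram i)"

locale Lawrence_Krammer =
  fixes n :: nat
begin

lemma LK_index_cases [consumes 1, case_names even odd]:
  assumes "i < Suc (2 * n)"
    and "\<And>k. k \<le> n \<Longrightarrow> i = 2 * k \<Longrightarrow> P" "\<And>k. k < n \<Longrightarrow> i = Suc (2 * k) \<Longrightarrow> P"
  shows P
proof (cases "even i")
  case True
  then obtain k where "i = 2 * k" by blast
  with assms show P by auto
next
  case False
  then obtain k where "i = Suc (2 * k)" by (auto elim: oddE)
  with assms show P by auto
qed

text \<open>\<open>X\<^sub>0\<close> scales \<open>v\<^sub>0\<close> and pairs \<open>v\<^sub>2\<^sub>k\<^sub>+\<^sub>1\<close> with \<open>v\<^sub>2\<^sub>k\<^sub>+\<^sub>2\<close>, whereas \<open>X\<^sub>1\<close> pairs \<open>v\<^sub>2\<^sub>k\<close> with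
  \<open>v\<^sub>2\<^sub>k\<^sub>+\<^sub>1\<close> and scales \<open>v\<^sub>2\<^sub>n\<close>. The next two rules split the indices accordingly.\<close>
lemma LK_index_cases0 [consumes 1, case_names zero odd even]:
  assumes "i < Suc (2 * n)" and "i = 0 \<Longrightarrow> P"
    and "\<And>k. k < n \<Longrightarrow> i = Suc (2 * k) \<Longrightarrow> P" "\<And>k. k < n \<Longrightarrow> i = Suc (Suc (2 * k)) \<Longrightarrow> P"
  shows P
  using assms(1)
proof (cases rule: LK_index_cases)
  case (even k)
  with assms(2) assms(4)[of "k - 1"] show P by (cases k) auto
qed (use assms in auto)

lemma LK_index_cases1 [consumes 1, case_names odd even last]:
  assumes "i < Suc (2 * n)"
    and "\<And>k. k < n \<Longrightarrow> i = Suc (2 * k) \<Longrightarrow> P" "\<And>k. k < n \<Longrightarrow> i = 2 * k \<Longrightarrow> P" "i = 2 * n \<Longrightarrow> P"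
  shows P
  using assms(1)
proof (cases rule: LK_index_cases)
  case (even k)
  with assms show P by (cases "k = n") auto
qed (use assms in auto)

lemma bv_carrier [simp]: "bv n i \<in> carrier_vec (Suc (2 * n))" "dim_vec (bv n i) = Suc (2 * n)"
  by (simp_all add: bv_def)

lemma bv_index: "i < Suc (2 * n) \<Longrightarrow> j < Suc (2 * n) \<Longrightarrow> bv n i $ j = (if j = i then 1 else 0)"
  by (simp add: bv_def)

lemma op_of_carrier [simp]: "op_of n f \<in> carrier_mat (Suc (2 * n)) (Suc (2 * n))"
  using mat_of_cols_carrier(1)[of "2 * n + 1" "map f [0..<2 * n + 1]"]
  by (simp add: op_of_def del: mat_of_cols_carrier)

lemma op_of_bv:
  assumes "j < Suc (2 * n)" "f j \<in> LK_space n"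
  shows "op_of n f *\<^sub>v bv n j = f j"
proof -
  have "op_of n f *\<^sub>v bv n j = col (op_of n f) j"
    using assms by (simp add: bv_def mult_mat_unit_vec[of _ "Suc (2 * n)"])
  also have "\<dots> = map f [0..<2 * n + 1] ! j"
    unfolding op_of_def using assms by (intro col_mat_of_cols) (auto simp del: upt_Suc)
  finally show ?thesis using assms by (simp del: upt_Suc)
qed

lemma X_carrier [simp]:
  "X0 n \<in> carrier_mat (Suc (2 * n)) (Suc (2 * n))" "X1 n \<in> carrier_mat (Suc (2 * n)) (Suc (2 * n))"
  "E0 n \<in> carrier_mat (Suc (2 * n)) (Suc (2 * n))"
  by (simp_all add: X0_def X1_def E0_def)

lemma X0_bv:
  "X0 n *\<^sub>v bv n 0 = ll \<cdot>\<^sub>v bv n 0"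
  "k < n \<Longrightarrow> X0 n *\<^sub>v bv n (Suc (2 * k)) = bv n (Suc (Suc (2 * k)))"
  "k < n \<Longrightarrow> X0 n *\<^sub>v bv n (Suc (Suc (2 * k))) =
     mm \<cdot>\<^sub>v bv n 0 - mm \<cdot>\<^sub>v bv n (Suc (Suc (2 * k))) + bv n (Suc (2 * k))"
  unfolding X0_def by (subst op_of_bv; simp)+

lemma X1_bv:
  "X1 n *\<^sub>v bv n (2 * n) = ll \<cdot>\<^sub>v bv n (2 * n)"
  "k < n \<Longrightarrow> X1 n *\<^sub>v bv n (2 * k) = bv n (Suc (2 * k))"
  "k < n \<Longrightarrow> X1 n *\<^sub>v bv n (Suc (2 * k)) =
     bv n (2 * k) - mm \<cdot>\<^sub>v bv n (Suc (2 * k)) + lmono 1 1 \<cdot>\<^sub>v bv n (2 * n)"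
  unfolding X1_def by (subst op_of_bv; simp)+

lemma gram_row_carrier [simp]:
  "gram_row n i \<in> carrier_vec (Suc (2 * n))" "dim_vec (gram_row n i) = Suc (2 * n)"
  by (simp_all add: gram_row_def)

lemma gram_row_bv: "j < Suc (2 * n) \<Longrightarrow> gram_row n i \<bullet> bv n j = gram i j"
  by (simp add: gram_row_def bv_def)

lemmas LK_linear =
  mult_add_distrib_mat_vec[where nr = "Suc (2 * n)" and nc = "Suc (2 * n)"]
  mult_minus_distrib_mat_vec[where nr = "Suc (2 * n)" and nc = "Suc (2 * n)"]
  mult_mat_smult_vec[where nr = "Suc (2 * n)" and nc = "Suc (2 * n)"]
  add_scalar_prod_distrib[where n = "Suc (2 * n)"] minus_scalar_prod_distrib[where n = "Suc (2 * n)"]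
  scalar_prod_add_distrib[where n = "Suc (2 * n)"] scalar_prod_minus_distrib[where n = "Suc (2 * n)"]

lemmas LK_mult_vec_carrier [simp] = mult_mat_vec_carrier[of _ "Suc (2 * n)" "Suc (2 * n)"]

lemma row_action_eqI:
  assumes "A \<in> carrier_mat (Suc (2 * n)) (Suc (2 * n))"
    and "a \<in> carrier_vec (Suc (2 * n))" "b \<in> carrier_vec (Suc (2 * n))"
    and "\<And>j. j < Suc (2 * n) \<Longrightarrow> a \<bullet> (A *\<^sub>v bv n j) = b \<bullet> bv n j"
    and "x \<in> LK_space n"
  shows "a \<bullet> (A *\<^sub>v x) = b \<bullet> x"
proof (rule functional_eqI[where N = "2 * n + 1" and f = "\<lambda>x. a \<bullet> (A *\<^sub>v x)" and g = "\<lambda>x. b \<bullet> x"])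
  fix i assume "i < 2 * n + 1"
  then show "a \<bullet> (A *\<^sub>v unit_vec (2 * n + 1) i) = b \<bullet> unit_vec (2 * n + 1) i"
    using assms(4)[of i] by (simp add: bv_def)
qed (use assms(1-3,5) in \<open>simp_all add: LK_linear\<close>)

lemma E0_mult: assumes "x \<in> LK_space n" shows "E0 n *\<^sub>v x = (gram_row n 0 \<bullet> x) \<cdot>\<^sub>v bv n 0"
proof -
  have "E0 n = rank_one (bv n 0) (gram_row n 0)"
  proof (rule mat_eqI_unit_vec[of _ "2 * n + 1" "2 * n + 1"])
    fix j assume "j < 2 * n + 1"
    then show "E0 n *\<^sub>v unit_vec (2 * n + 1) j = rank_one (bv n 0) (gram_row n 0) *\<^sub>v unit_vec (2 * n + 1) j"
      unfolding bv_def[symmetric] E0_def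
      by (subst op_of_bv) (auto simp: rank_one_mult_vec gram_row_bv gram_def)
  qed auto
  with assms show ?thesis by (simp add: rank_one_mult_vec)
qed

text \<open>The generators act on the rows of \<open>gram\<close> in the same pattern as on the basis vectors: a scaled
  row, plain steps along the ladder in one direction, and steps with correction terms in \<open>m\<close> in the
  other. The entry \<open>\<tau>\<close> fits in because \<open>m\<tau> = l - l\<^sup>-\<^sup>1 + m\<close>.\<close>
lemma gram_row_X0_zero:
  assumes "x \<in> LK_space n"
  shows "gram_row n 0 \<bullet> (X0 n *\<^sub>v x) = ll * (gram_row n 0 \<bullet> x)"
proof -
  have "gram_row n 0 \<bullet> (X0 n *\<^sub>v x) = (ll \<cdot>\<^sub>v gram_row n 0) \<bullet> x"
  proof (rule row_action_eqI)
    fix j assume "j < Suc (2 * n)"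
    then show "gram_row n 0 \<bullet> (X0 n *\<^sub>v bv n j) = (ll \<cdot>\<^sub>v gram_row n 0) \<bullet> bv n j"
      using assms
      by (cases rule: LK_index_cases0; simp add: X0_bv LK_linear gram_row_bv gram_simps; auto simp: tau_def ring_distribs)
  qed (use assms in auto)
  with assms show ?thesis by simp
qed

lemma gram_row_X0_even:
  assumes "k < n" "x \<in> LK_space n"
  shows "gram_row n (Suc (Suc (2 * k))) \<bullet> (X0 n *\<^sub>v x) = gram_row n (Suc (2 * k)) \<bullet> x"
proof (rule row_action_eqI)
  fix j assume "j < Suc (2 * n)"
  then show "gram_row n (Suc (Suc (2 * k))) \<bullet> (X0 n *\<^sub>v bv n j) = gram_row n (Suc (2 * k)) \<bullet> bv n j"
    using assms
      by (cases rule: LK_index_cases0; simp add: X0_bv LK_linear gram_row_bv gram_simps; auto simp: tau_def ring_distribs)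
qed (use assms in auto)

lemma gram_row_X0_odd:
  assumes "k < n" "x \<in> LK_space n"
  shows "gram_row n (Suc (2 * k)) \<bullet> (X0 n *\<^sub>v x) =
    gram_row n (Suc (Suc (2 * k))) \<bullet> x - mm * (gram_row n (Suc (2 * k)) \<bullet> x)
      + lmono 1 1 * (gram_row n 0 \<bullet> x)"
proof -
  let ?b = "gram_row n (Suc (Suc (2 * k))) - mm \<cdot>\<^sub>v gram_row n (Suc (2 * k)) + lmono 1 1 \<cdot>\<^sub>v gram_row n 0"
  have "gram_row n (Suc (2 * k)) \<bullet> (X0 n *\<^sub>v x) = ?b \<bullet> x"
  proof (rule row_action_eqI)
    fix j assume "j < Suc (2 * n)"
    then show "gram_row n (Suc (2 * k)) \<bullet> (X0 n *\<^sub>v bv n j) = ?b \<bullet> bv n j"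
      using assms
      by (cases rule: LK_index_cases0; simp add: X0_bv LK_linear gram_row_bv gram_simps; auto simp: tau_def ring_distribs)
  qed (use assms(2) in auto)
  with assms(2) show ?thesis by (simp add: LK_linear)
qed

lemma gram_row_X1_last:
  assumes "x \<in> LK_space n"
  shows "gram_row n (2 * n) \<bullet> (X1 n *\<^sub>v x) = ll * (gram_row n (2 * n) \<bullet> x)"
proof -
  have "gram_row n (2 * n) \<bullet> (X1 n *\<^sub>v x) = (ll \<cdot>\<^sub>v gram_row n (2 * n)) \<bullet> x"
  proof (rule row_action_eqI)
    fix j assume "j < Suc (2 * n)"
    then show "gram_row n (2 * n) \<bullet> (X1 n *\<^sub>v bv n j) = (ll \<cdot>\<^sub>v gram_row n (2 * n)) \<bullet> bv n j"
      using assms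
      by (cases rule: LK_index_cases1; simp add: X1_bv LK_linear gram_row_bv gram_simps; auto simp: tau_def ring_distribs)
  qed (use assms in auto)
  with assms show ?thesis by simp
qed

lemma gram_row_X1_odd:
  assumes "k < n" "x \<in> LK_space n"
  shows "gram_row n (Suc (2 * k)) \<bullet> (X1 n *\<^sub>v x) = gram_row n (2 * k) \<bullet> x"
proof (rule row_action_eqI)
  fix j assume "j < Suc (2 * n)"
  then show "gram_row n (Suc (2 * k)) \<bullet> (X1 n *\<^sub>v bv n j) = gram_row n (2 * k) \<bullet> bv n j"
    using assms
      by (cases rule: LK_index_cases1; simp add: X1_bv LK_linear gram_row_bv gram_simps; auto simp: tau_def ring_distribs)
qed (use assms in auto)

lemma gram_row_X1_even:
  assumes "k < n" "x \<in> LK_space n"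
  shows "gram_row n (2 * k) \<bullet> (X1 n *\<^sub>v x) =
    gram_row n (Suc (2 * k)) \<bullet> x - mm * (gram_row n (2 * k) \<bullet> x) + mm * (gram_row n (2 * n) \<bullet> x)"
proof -
  let ?b = "gram_row n (Suc (2 * k)) - mm \<cdot>\<^sub>v gram_row n (2 * k) + mm \<cdot>\<^sub>v gram_row n (2 * n)"
  have "gram_row n (2 * k) \<bullet> (X1 n *\<^sub>v x) = ?b \<bullet> x"
  proof (rule row_action_eqI)
    fix j assume "j < Suc (2 * n)"
    then show "gram_row n (2 * k) \<bullet> (X1 n *\<^sub>v bv n j) = ?b \<bullet> bv n j"
      using assms
      by (cases rule: LK_index_cases1; simp add: X1_bv LK_linear gram_row_bv gram_simps; auto simp: tau_def ring_distribs)
  qed (use assms(2) in auto)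
  with assms(2) show ?thesis by (simp add: LK_linear)
qed

lemmas LK_mat_simps =
  mult_carrier_mat[of _ "Suc (2 * n)" "Suc (2 * n)" _ "Suc (2 * n)"] assoc_mult_mat[of _ "Suc (2 * n)" "Suc (2 * n)" _ "Suc (2 * n)" _ "Suc (2 * n)"]
  assoc_mult_mat_vec[of _ "Suc (2 * n)" "Suc (2 * n)" _ "Suc (2 * n)"]
  left_mult_one_mat[of _ "Suc (2 * n)" "Suc (2 * n)"] right_mult_one_mat[of _ "Suc (2 * n)" "Suc (2 * n)"]

lemma LK_map_eqI:
  assumes "\<And>x. x \<in> LK_space n \<Longrightarrow> f x \<in> LK_space n"
    and "\<And>x. x \<in> LK_space n \<Longrightarrow> g x \<in> LK_space n"
    and "\<And>u v. u \<in> LK_space n \<Longrightarrow> v \<in> LK_space n \<Longrightarrow> f (u + v) = f u + f v"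
    and "\<And>u v. u \<in> LK_space n \<Longrightarrow> v \<in> LK_space n \<Longrightarrow> g (u + v) = g u + g v"
    and "\<And>c v. v \<in> LK_space n \<Longrightarrow> f (c \<cdot>\<^sub>v v) = c \<cdot>\<^sub>v f v"
    and "\<And>c v. v \<in> LK_space n \<Longrightarrow> g (c \<cdot>\<^sub>v v) = c \<cdot>\<^sub>v g v"
    and unit: "\<And>j. j < Suc (2 * n) \<Longrightarrow> f (bv n j) = g (bv n j)"
    and x: "x \<in> LK_space n"
  shows "f x = g x"
proof (rule eq_vecI)
  fix i assume "i < dim_vec (g x)"
  then have i: "i < 2 * n + 1" using assms(2)[OF x] by simp
  have dim: "dim_vec (f y) = 2 * n + 1" "dim_vec (g y) = 2 * n + 1" if "y \<in> LK_space n" for y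
    using assms(1,2)[OF that] by auto
  show "f x $ i = g x $ i"
  proof (rule functional_eqI[where N = "2 * n + 1" and f = "\<lambda>x. f x $ i" and g = "\<lambda>x. g x $ i"])
    fix j assume "j < 2 * n + 1"
    then show "f (unit_vec (2 * n + 1) j) $ i = g (unit_vec (2 * n + 1) j) $ i"
      using unit[of j] by (simp add: bv_def)
  qed (use i assms(3-6) dim x in auto)
qed (use assms(1,2)[OF x] in auto)

lemma LK_mat_eqI:
  assumes "A \<in> carrier_mat (Suc (2 * n)) (Suc (2 * n))" "B \<in> carrier_mat (Suc (2 * n)) (Suc (2 * n))"
    and "\<And>j. j < Suc (2 * n) \<Longrightarrow> A *\<^sub>v bv n j = B *\<^sub>v bv n j"
  shows "A = B"
  using assms by (intro mat_eqI_unit_vec[of _ "2 * n + 1" "2 * n + 1"]) (auto simp: bv_def)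

section \<open>Invertibility of the generators\<close>

lemma op_inv_eqI:
  assumes "A \<in> carrier_mat (Suc (2 * n)) (Suc (2 * n))" "B \<in> carrier_mat (Suc (2 * n)) (Suc (2 * n))"
    and "A * B = 1\<^sub>m (Suc (2 * n))" "B * A = 1\<^sub>m (Suc (2 * n))"
  shows "op_inv n A = B"
proof -
  interpret ring "ring_mat TYPE(laurent) (2 * n + 1) ()" by (rule ring_mat)
  show ?thesis
    unfolding op_inv_def using assms by (intro inv_char) (simp_all add: ring_mat_simps)
qed

text \<open>These are \<open>X\<^sub>0 + m - m E\<^sub>0\<close> and \<open>X\<^sub>1 + m - m E\<^sub>1\<close> on the basis, as the skein relation suggests,
  with \<open>E\<^sub>1\<close> the rank-one operator \<open>x \<mapsto> a\<^sub>2\<^sub>n(x) v\<^sub>2\<^sub>n\<close>.\<close>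
definition X0_inv :: "laurent mat" where
  "X0_inv = op_of n (\<lambda>j.
     if j = 0 then ll_inv \<cdot>\<^sub>v bv n 0
     else if even j then bv n (j - 1)
     else bv n (j + 1) + mm \<cdot>\<^sub>v bv n j - lmono 1 (- 1) \<cdot>\<^sub>v bv n 0)"

definition X1_inv :: "laurent mat" where
  "X1_inv = op_of n (\<lambda>j.
     if j = 2 * n then ll_inv \<cdot>\<^sub>v bv n (2 * n)
     else if even j then bv n (j + 1) + mm \<cdot>\<^sub>v bv n j - mm \<cdot>\<^sub>v bv n (2 * n)
     else bv n (j - 1))"

lemma X0_inv_bv:
  "X0_inv *\<^sub>v bv n 0 = ll_inv \<cdot>\<^sub>v bv n 0"
  "k < n \<Longrightarrow> X0_inv *\<^sub>v bv n (Suc (2 * k)) =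
     bv n (Suc (Suc (2 * k))) + mm \<cdot>\<^sub>v bv n (Suc (2 * k)) - lmono 1 (- 1) \<cdot>\<^sub>v bv n 0"
  "k < n \<Longrightarrow> X0_inv *\<^sub>v bv n (Suc (Suc (2 * k))) = bv n (Suc (2 * k))"
  unfolding X0_inv_def by (subst op_of_bv; simp)+

lemma X1_inv_bv:
  "X1_inv *\<^sub>v bv n (2 * n) = ll_inv \<cdot>\<^sub>v bv n (2 * n)"
  "k < n \<Longrightarrow> X1_inv *\<^sub>v bv n (2 * k) =
     bv n (Suc (2 * k)) + mm \<cdot>\<^sub>v bv n (2 * k) - mm \<cdot>\<^sub>v bv n (2 * n)"
  "k < n \<Longrightarrow> X1_inv *\<^sub>v bv n (Suc (2 * k)) = bv n (2 * k)"
  unfolding X1_inv_def by (subst op_of_bv; simp)+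

lemma X_inv_carrier [simp]:
  "X0_inv \<in> carrier_mat (Suc (2 * n)) (Suc (2 * n))" "X1_inv \<in> carrier_mat (Suc (2 * n)) (Suc (2 * n))"
  by (simp_all add: X0_inv_def X1_inv_def)

lemma X0_inverse:
  "X0 n * X0_inv = 1\<^sub>m (Suc (2 * n))" "X0_inv * X0 n = 1\<^sub>m (Suc (2 * n))"
proof -
  have "X0 n *\<^sub>v (X0_inv *\<^sub>v bv n j) = bv n j \<and> X0_inv *\<^sub>v (X0 n *\<^sub>v bv n j) = bv n j"
    if "j < Suc (2 * n)" for j
    using that
    by (cases rule: LK_index_cases0; simp add: X0_bv X0_inv_bv LK_linear smult_smult_assoc;
        intro conjI eq_vecI; simp add: ring_distribs bv_index)
  then show "X0 n * X0_inv = 1\<^sub>m (Suc (2 * n))" "X0_inv * X0 n = 1\<^sub>m (Suc (2 * n))"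
    by (auto intro!: LK_mat_eqI simp: LK_mat_simps)
qed

lemma X1_inverse:
  "X1 n * X1_inv = 1\<^sub>m (Suc (2 * n))" "X1_inv * X1 n = 1\<^sub>m (Suc (2 * n))"
proof -
  have "X1 n *\<^sub>v (X1_inv *\<^sub>v bv n j) = bv n j \<and> X1_inv *\<^sub>v (X1 n *\<^sub>v bv n j) = bv n j"
    if "j < Suc (2 * n)" for j
    using that
    by (cases rule: LK_index_cases1; simp add: X1_bv X1_inv_bv LK_linear smult_smult_assoc;
        intro conjI eq_vecI; simp add: ring_distribs bv_index)
  then show "X1 n * X1_inv = 1\<^sub>m (Suc (2 * n))" "X1_inv * X1 n = 1\<^sub>m (Suc (2 * n))"
    by (auto intro!: LK_mat_eqI simp: LK_mat_simps)
qed

lemma op_inv_X: "op_inv n (X0 n) = X0_inv" "op_inv n (X1 n) = X1_inv"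
  by (simp_all add: op_inv_eqI X0_inverse X1_inverse)

section \<open>The coefficients of the form\<close>

lemma op_prod_Nil [simp]: "op_prod n [] = 1\<^sub>m (Suc (2 * n))"
  by (simp add: op_prod_def)

lemma op_prod_Cons [simp]: "op_prod n (A # As) = A * op_prod n As"
  by (simp add: op_prod_def)

lemma op_prod_carrier:
  "set As \<subseteq> carrier_mat (Suc (2 * n)) (Suc (2 * n)) \<Longrightarrow> op_prod n As \<in> carrier_mat (Suc (2 * n)) (Suc (2 * n))"
  by (induction As) auto

lemma op_prod_append:
  "set As \<subseteq> carrier_mat (Suc (2 * n)) (Suc (2 * n)) \<Longrightarrow> set Bs \<subseteq> carrier_mat (Suc (2 * n)) (Suc (2 * n)) \<Longrightarrow>
   op_prod n (As @ Bs) = op_prod n As * op_prod n Bs"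
proof (induction As)
  case Nil
  then show ?case using op_prod_carrier[of Bs] by simp
next
  case (Cons A As)
  then show ?case
    using op_prod_carrier[of As] op_prod_carrier[of Bs]
    by (simp add: LK_mat_simps)
qed

lemma op_prod_alt_carrier [simp]:
  assumes "A \<in> carrier_mat (Suc (2 * n)) (Suc (2 * n))" "B \<in> carrier_mat (Suc (2 * n)) (Suc (2 * n))"
  shows "op_prod n (alt_begin A B k) \<in> carrier_mat (Suc (2 * n)) (Suc (2 * n))"
    and "op_prod n (alt_end A B k) \<in> carrier_mat (Suc (2 * n)) (Suc (2 * n))"
  using set_alt_begin[of A B k] set_alt_begin[of B A k] assms
  by (auto simp: alt_end_def intro!: op_prod_carrier)

text \<open>The generator that moves \<open>v\<^sub>i\<close> to \<open>v\<^sub>i\<^sub>+\<^sub>1\<close>; it is the letter by which the alternating word in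
  \<open>p\<^sub>i\<^sub>+\<^sub>1\<close> exceeds the one in \<open>p\<^sub>i\<close>.\<close>
definition ladder :: "nat \<Rightarrow> laurent mat" where
  "ladder i = (if even i then X1 n else X0 n)"

lemma ladder_carrier [simp]: "ladder i \<in> carrier_mat (Suc (2 * n)) (Suc (2 * n))"
  by (simp add: ladder_def)

lemma ladder_bv:
  assumes "i < 2 * n"
  shows "ladder i *\<^sub>v bv n i = bv n (Suc i)"
proof -
  from assms have "i < Suc (2 * n)" by simp
  then show ?thesis
    by (cases rule: LK_index_cases) (use assms in \<open>auto simp: ladder_def X0_bv X1_bv\<close>)
qed

lemma gram_row_ladder:
  assumes "i < 2 * n" "x \<in> LK_space n"
  shows "gram_row n (Suc i) \<bullet> (ladder i *\<^sub>v x) = gram_row n i \<bullet> x"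
proof -
  from assms have "i < Suc (2 * n)" by simp
  then show ?thesis
    by (cases rule: LK_index_cases)
      (use assms in \<open>auto simp: ladder_def gram_row_X0_even gram_row_X1_odd\<close>)
qed

lemma ladder_op_inv: 
  "op_inv n (ladder i) \<in> carrier_mat (Suc (2 * n)) (Suc (2 * n))"
  "ladder i * op_inv n (ladder i) = 1\<^sub>m (Suc (2 * n))" "op_inv n (ladder i) * ladder i = 1\<^sub>m (Suc (2 * n))"
  by (simp_all add: ladder_def op_inv_X X0_inverse X1_inverse)

lemma p_op_0: "p_op n 0 = E0 n"
  by (simp add: p_op_def alt_end_def LK_mat_simps)

lemma p_op_carrier [simp]: "p_op n i \<in> carrier_mat (Suc (2 * n)) (Suc (2 * n))"
  unfolding p_op_def op_inv_X by (intro mult_carrier_mat[of _ _ "Suc (2 * n)"]) auto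

lemma p_op_Suc: "p_op n (Suc i) = ladder i * p_op n i * op_inv n (ladder i)"
proof -
  have "op_prod n (alt_end (X0 n) (X1 n) (Suc i)) = ladder i * op_prod n (alt_end (X0 n) (X1 n) i)"
    by (simp add: alt_end_Suc_Cons ladder_def)
  moreover have "op_prod n (alt_begin X1_inv X0_inv (Suc i)) = op_prod n (alt_begin X1_inv X0_inv i) * op_inv n (ladder i)"
    unfolding alt_begin_Suc_snoc
    using set_alt_begin[of X1_inv X0_inv i]
    by (subst op_prod_append) (auto simp: ladder_def op_inv_X LK_mat_simps)
  ultimately show ?thesis
    using ladder_op_inv(1)[of i]
    by (simp add: p_op_def op_inv_X LK_mat_simps)
qed

text \<open>Conjugating a rank-one operator by the ladder generator moves its vector and its row one step
  up, so the claim propagates from \<open>p\<^sub>0 = E\<^sub>0\<close>.\<close>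
lemma p_op_mult:
  "i \<le> 2 * n \<Longrightarrow> x \<in> LK_space n \<Longrightarrow> p_op n i *\<^sub>v x = (gram_row n i \<bullet> x) \<cdot>\<^sub>v bv n i"
proof (induction i arbitrary: x)
  case 0
  then show ?case by (simp add: p_op_0 E0_mult)
next
  case (Suc i)
  let ?y = "op_inv n (ladder i) *\<^sub>v x"
  have y: "?y \<in> LK_space n" "ladder i *\<^sub>v ?y = x"
    using ladder_op_inv[of i] Suc.prems(2)
    by (simp_all flip: assoc_mult_mat_vec[of _ "Suc (2 * n)" "Suc (2 * n)" _ "Suc (2 * n)"])
  have "p_op n (Suc i) *\<^sub>v x = ladder i *\<^sub>v (p_op n i *\<^sub>v ?y)"
    using ladder_op_inv(1)[of i] Suc.prems(2) y(1)
    by (simp add: p_op_Suc LK_mat_simps)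
  also have "\<dots> = ladder i *\<^sub>v ((gram_row n i \<bullet> ?y) \<cdot>\<^sub>v bv n i)"
    using Suc.IH[OF _ y(1)] Suc.prems(1) by simp
  also have "\<dots> = (gram_row n (Suc i) \<bullet> x) \<cdot>\<^sub>v bv n (Suc i)"
    using Suc.prems(1) y gram_row_ladder[of i ?y] by (simp add: LK_linear ladder_bv)
  finally show ?case .
qed

lemma alpha_eq_gram:
  assumes "i \<le> 2 * n" "j \<le> 2 * n"
  shows "alpha n i j = gram i j"
  unfolding alpha_def
proof (rule the_equality)
  show "p_op n i *\<^sub>v bv n j = gram i j \<cdot>\<^sub>v bv n i"
    using assms by (simp add: p_op_mult gram_row_bv)
  fix a assume "p_op n i *\<^sub>v bv n j = a \<cdot>\<^sub>v bv n i"
  then have "(gram i j \<cdot>\<^sub>v bv n i) $ i = (a \<cdot>\<^sub>v bv n i) $ i"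
    using assms by (simp add: p_op_mult gram_row_bv)
  then show "a = gram i j"
    using assms by (simp add: bv_index)
qed

section \<open>Invariance of the form under the generators\<close>

text \<open>In this shape the form pairs the coordinates of \<open>v\<close> with the rows applied to \<open>w\<close>, so its
  invariance follows from the action of the generators on rows.\<close>
lemma LK_form_eq:
  assumes "w \<in> LK_space n"
  shows "LK_form n v w = (\<Sum>i\<le>2 * n. v $ i * bar_conj (gram_row n i \<bullet> w))"
  unfolding LK_form_def
proof (rule sum.cong)
  fix i assume i: "i \<in> {..2 * n}"
  have "gram_row n i \<bullet> w = (\<Sum>j\<le>2 * n. gram i j * w $ j)"
    unfolding scalar_prod_def using assms
    by (intro sum.cong) (auto simp: gram_row_def atLeast0LessThan lessThan_Suc_atMost)
  then have "bar_conj (gram_row n i \<bullet> w) = (\<Sum>j\<le>2 * n. bar_conj (gram i j) * bar_conj (w $ j))"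
    by (simp add: bar_conj_sum)
  then show "(\<Sum>j\<le>2 * n. v $ i * bar_conj (w $ j) * bar_conj (alpha n i j))
      = v $ i * bar_conj (gram_row n i \<bullet> w)"
    using i by (simp add: sum_distrib_left alpha_eq_gram mult_ac)
qed simp

lemma LK_form_bv:
  assumes "i < Suc (2 * n)" "w \<in> LK_space n"
  shows "LK_form n (bv n i) w = bar_conj (gram_row n i \<bullet> w)"
proof -
  have "LK_form n (bv n i) w = (\<Sum>j\<le>2 * n. if j = i then bar_conj (gram_row n i \<bullet> w) else 0)"
    unfolding LK_form_eq[OF assms(2)] using assms(1)
    by (intro sum.cong) (auto simp: bv_index)
  with assms show ?thesis by simp
qed

lemma LK_form_add_left:
  assumes "u \<in> LK_space n" "v \<in> LK_space n" 
  shows "LK_form n (u + v) w = LK_form n u w + LK_form n v w"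
  using assms unfolding LK_form_def
  by (simp add: distrib_right sum.distrib flip: lessThan_Suc_atMost)

lemma LK_form_smult_left:
  assumes "v \<in> LK_space n" 
  shows "LK_form n (c \<cdot>\<^sub>v v) w = c * LK_form n v w"
  using assms unfolding LK_form_def
  by (auto simp: sum_distrib_left mult_ac intro!: sum.cong)

lemma LK_form_minus_left:
  assumes "u \<in> LK_space n" "v \<in> LK_space n"
  shows "LK_form n (u - v) w = LK_form n u w - LK_form n v w"
  using assms unfolding LK_form_def
  by (simp add: left_diff_distrib sum_subtractf flip: lessThan_Suc_atMost)

lemma LK_form_hermitian: "LK_form n w v = bar_conj (LK_form n v w)"
  unfolding LK_form_def bar_conj_sum
  by (subst sum.swap) (auto intro!: sum.cong simp: alpha_eq_gram gram_hermitian mult_ac)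

lemma hermitian_LK_form: "hermitian_form n (LK_form n)"
  unfolding hermitian_form_def
proof (intro conjI ballI allI)
  fix u v w assume *: "u \<in> LK_space n" "v \<in> LK_space n" "w \<in> LK_space n"
  show "LK_form n (u + v) w = LK_form n u w + LK_form n v w"
    using * by (simp add: LK_form_add_left)
  show "LK_form n u (v + w) = LK_form n u v + LK_form n u w"
    using * LK_form_add_left[of v w u] by (simp add: LK_form_hermitian[of u])
next
  fix f g v w assume *: "v \<in> LK_space n" "w \<in> LK_space n"
  have "LK_form n v (g \<cdot>\<^sub>v w) = bar_conj g * LK_form n v w"
    using * LK_form_smult_left[of w g v] by (simp add: LK_form_hermitian[of v])
  then show "LK_form n (f \<cdot>\<^sub>v v) (g \<cdot>\<^sub>v w) = f * bar_conj g * LK_form n v w"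
    using * by (simp add: LK_form_smult_left mult_ac)
qed (rule LK_form_hermitian)

text \<open>By linearity in \<open>v\<close> only basis vectors matter. On \<open>v\<^sub>0\<close> the factors \<open>l\<close> and \<open>l\<^sup>-\<^sup>1\<close> cancel, and on
  \<open>v\<^sub>2\<^sub>k\<^sub>+\<^sub>1\<close> both sides climb the ladder. On \<open>v\<^sub>2\<^sub>k\<^sub>+\<^sub>2\<close> the correction terms in \<open>X\<^sub>0 v\<^sub>2\<^sub>k\<^sub>+\<^sub>2\<close>
  cancel those of the row \<open>a\<^sub>2\<^sub>k\<^sub>+\<^sub>1\<close>, since the latter enter conjugated and \<open>m\<close> changes sign.\<close>
lemma LK_form_X0:
  assumes "v \<in> LK_space n" "w \<in> LK_space n"
  shows "LK_form n (X0 n *\<^sub>v v) (X0 n *\<^sub>v w) = LK_form n v w"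
proof (rule functional_eqI[where N = "2 * n + 1" and x = v
      and f = "\<lambda>v. LK_form n (X0 n *\<^sub>v v) (X0 n *\<^sub>v w)" and g = "\<lambda>v. LK_form n v w"])
  have Xw: "X0 n *\<^sub>v w \<in> LK_space n" using assms(2) by simp
  fix j assume "j < 2 * n + 1"
  then have "j < Suc (2 * n)" by simp
  then show "LK_form n (X0 n *\<^sub>v unit_vec (2 * n + 1) j) (X0 n *\<^sub>v w) = LK_form n (unit_vec (2 * n + 1) j) w"
    unfolding bv_def[symmetric] using assms(2) Xw
    by (cases rule: LK_index_cases0)
      (simp_all add: X0_bv LK_form_add_left LK_form_minus_left LK_form_smult_left LK_form_bv
        gram_row_X0_zero gram_row_X0_even gram_row_X0_odd bar_conj_lmono ring_distribs)
qed (use assms in \<open>simp_all add: LK_linear LK_form_add_left LK_form_smult_left\<close>)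

lemma LK_form_X1:
  assumes "v \<in> LK_space n" "w \<in> LK_space n"
  shows "LK_form n (X1 n *\<^sub>v v) (X1 n *\<^sub>v w) = LK_form n v w"
proof (rule functional_eqI[where N = "2 * n + 1" and x = v
      and f = "\<lambda>v. LK_form n (X1 n *\<^sub>v v) (X1 n *\<^sub>v w)" and g = "\<lambda>v. LK_form n v w"])
  have Xw: "X1 n *\<^sub>v w \<in> LK_space n" using assms(2) by simp
  fix j assume "j < 2 * n + 1"
  then have "j < Suc (2 * n)" by simp
  then show "LK_form n (X1 n *\<^sub>v unit_vec (2 * n + 1) j) (X1 n *\<^sub>v w) = LK_form n (unit_vec (2 * n + 1) j) w"
    unfolding bv_def[symmetric] using assms(2) Xw
    by (cases rule: LK_index_cases1)
      (simp_all add: X1_bv LK_form_add_left LK_form_minus_left LK_form_smult_left LK_form_bv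
        gram_row_X1_last gram_row_X1_odd gram_row_X1_even bar_conj_lmono ring_distribs)
qed (use assms in \<open>simp_all add: LK_linear LK_form_add_left LK_form_smult_left\<close>)

section \<open>The braid relation\<close>

text \<open>The skein relation \<open>X\<^sup>2 = 1 - mX + ml E\<close> with \<open>E\<close> of rank one is linear in the argument.
  The factor \<open>l\<close> appears because \<open>X E = l E\<close>.\<close>
lemma skein_extend:
  assumes A: "A \<in> carrier_mat (Suc (2 * n)) (Suc (2 * n))"
    and a: "a \<in> LK_space n" and e: "e \<in> LK_space n"
    and basis: "\<And>j. j < Suc (2 * n) \<Longrightarrow>
      A *\<^sub>v (A *\<^sub>v bv n j) = bv n j - mm \<cdot>\<^sub>v (A *\<^sub>v bv n j) + (lmono 1 1 * (a \<bullet> bv n j)) \<cdot>\<^sub>v e"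
    and x: "x \<in> LK_space n"
  shows "A *\<^sub>v (A *\<^sub>v x) = x - mm \<cdot>\<^sub>v (A *\<^sub>v x) + (lmono 1 1 * (a \<bullet> x)) \<cdot>\<^sub>v e"
proof (rule LK_map_eqI[where x = x and f = "\<lambda>x. A *\<^sub>v (A *\<^sub>v x)"
      and g = "\<lambda>x. x - mm \<cdot>\<^sub>v (A *\<^sub>v x) + (lmono 1 1 * (a \<bullet> x)) \<cdot>\<^sub>v e"])
  note dim = carrier_matD[OF A] carrier_vecD[OF a] carrier_vecD[OF e]
  fix u v assume "u \<in> LK_space n" "v \<in> LK_space n"
  with A a e dim show "u + v - mm \<cdot>\<^sub>v (A *\<^sub>v (u + v)) + (lmono 1 1 * (a \<bullet> (u + v))) \<cdot>\<^sub>v e =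
    u - mm \<cdot>\<^sub>v (A *\<^sub>v u) + (lmono 1 1 * (a \<bullet> u)) \<cdot>\<^sub>v e +
    (v - mm \<cdot>\<^sub>v (A *\<^sub>v v) + (lmono 1 1 * (a \<bullet> v)) \<cdot>\<^sub>v e)"
    by (simp add: LK_linear) (intro eq_vecI; simp add: ring_distribs del: index_mult_mat_vec)
next
  note dim = carrier_matD[OF A] carrier_vecD[OF a] carrier_vecD[OF e]
  fix c v assume "v \<in> LK_space n"
  with A a e dim show "c \<cdot>\<^sub>v v - mm \<cdot>\<^sub>v (A *\<^sub>v (c \<cdot>\<^sub>v v)) + (lmono 1 1 * (a \<bullet> (c \<cdot>\<^sub>v v))) \<cdot>\<^sub>v e =
    c \<cdot>\<^sub>v (v - mm \<cdot>\<^sub>v (A *\<^sub>v v) + (lmono 1 1 * (a \<bullet> v)) \<cdot>\<^sub>v e)"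
    by (simp add: LK_linear) (intro eq_vecI; simp add: ring_distribs mult_ac del: index_mult_mat_vec)
qed (use A a e basis x in \<open>simp_all add: LK_linear\<close>)

lemma X0_skein:
  assumes "x \<in> LK_space n"
  shows "X0 n *\<^sub>v (X0 n *\<^sub>v x) =
    x - mm \<cdot>\<^sub>v (X0 n *\<^sub>v x) + (lmono 1 1 * (gram_row n 0 \<bullet> x)) \<cdot>\<^sub>v bv n 0"
proof (rule skein_extend)
  fix j assume "j < Suc (2 * n)"
  then show "X0 n *\<^sub>v (X0 n *\<^sub>v bv n j) =
    bv n j - mm \<cdot>\<^sub>v (X0 n *\<^sub>v bv n j) + (lmono 1 1 * (gram_row n 0 \<bullet> bv n j)) \<cdot>\<^sub>v bv n 0"
    by (cases rule: LK_index_cases0; simp add: X0_bv LK_linear gram_row_bv gram_simps smult_smult_assoc;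
        intro eq_vecI; simp add: ring_distribs bv_index tau_def)
qed (use assms in simp_all)

lemma X1_skein:
  assumes "x \<in> LK_space n"
  shows "X1 n *\<^sub>v (X1 n *\<^sub>v x) =
    x - mm \<cdot>\<^sub>v (X1 n *\<^sub>v x) + (lmono 1 1 * (gram_row n (2 * n) \<bullet> x)) \<cdot>\<^sub>v bv n (2 * n)"
proof (rule skein_extend)
  fix j assume "j < Suc (2 * n)"
  then show "X1 n *\<^sub>v (X1 n *\<^sub>v bv n j) =
    bv n j - mm \<cdot>\<^sub>v (X1 n *\<^sub>v bv n j) + (lmono 1 1 * (gram_row n (2 * n) \<bullet> bv n j)) \<cdot>\<^sub>v bv n (2 * n)"
    by (cases rule: LK_index_cases1; simp add: X1_bv LK_linear gram_row_bv gram_simps smult_smult_assoc;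
        intro eq_vecI; simp add: ring_distribs bv_index tau_def)
qed (use assms in simp_all)

text \<open>The sums of \<open>v\<^sub>j - v\<^sub>2\<^sub>n\<^sub>-\<^sub>j\<close> over the first \<open>k\<close> even, respectively odd, values of \<open>j\<close>. Up to
  the factor \<open>m\<close> they are the corrections that \<open>v\<^sub>2\<^sub>n\<close> picks up when it descends the ladder.\<close>
definition even_skew :: "nat \<Rightarrow> laurent vec" where
  "even_skew k = vec (2 * n + 1) (\<lambda>r. \<Sum>s<k. bv n (2 * s) $ r - bv n (2 * (n - s)) $ r)"

definition odd_skew :: "nat \<Rightarrow> laurent vec" where
  "odd_skew k = vec (2 * n + 1) (\<lambda>r. \<Sum>s<k. bv n (Suc (2 * s)) $ r - bv n (Suc (2 * (n - Suc s))) $ r)"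

lemma skew_carrier [simp]:
  "even_skew k \<in> carrier_vec (Suc (2 * n))" "odd_skew k \<in> carrier_vec (Suc (2 * n))"
  "dim_vec (even_skew k) = Suc (2 * n)" "dim_vec (odd_skew k) = Suc (2 * n)"
  by (simp_all add: even_skew_def odd_skew_def)

lemma skew_0: "even_skew 0 = 0\<^sub>v (Suc (2 * n))" "odd_skew 0 = 0\<^sub>v (Suc (2 * n))"
  by (auto simp: even_skew_def odd_skew_def)

lemma skew_Suc:
  "even_skew (Suc k) = even_skew k + (bv n (2 * k) - bv n (2 * (n - k)))"
  "odd_skew (Suc k) = odd_skew k + (bv n (Suc (2 * k)) - bv n (Suc (2 * (n - Suc k))))"
  by (auto simp: even_skew_def odd_skew_def)

text \<open>The reflection \<open>j \<mapsto> 2n - j\<close> permutes the odd indices.\<close>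
lemma odd_skew_n: "odd_skew n = 0\<^sub>v (Suc (2 * n))"
  by (rule eq_vecI)
    (simp_all add: odd_skew_def sum_subtractf
      sum.nat_diff_reindex[of "\<lambda>s. bv n (Suc (2 * s)) $ _" n])

lemma mult_zero_LK [simp]:
  "A \<in> carrier_mat (Suc (2 * n)) (Suc (2 * n)) \<Longrightarrow> A *\<^sub>v 0\<^sub>v (Suc (2 * n)) = (0\<^sub>v (Suc (2 * n)) :: laurent vec)"
  by (rule eq_vecI) auto

lemma X0_odd_skew:
  "k \<le> n \<Longrightarrow> X0 n *\<^sub>v odd_skew k = even_skew (Suc k) - (bv n 0 - bv n (2 * (n - k)))"
proof (induction k)
  case 0
  then show ?case by (auto simp: skew_0 skew_Suc)
next
  case (Suc k)
  define p where "p = n - Suc k"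
  with Suc.prems have p: "n - k = Suc p" "n - Suc k = p" "p < n" by auto
  have "X0 n *\<^sub>v odd_skew (Suc k) = even_skew (Suc k) - (bv n 0 - bv n (2 * (n - k)))
      + (bv n (Suc (Suc (2 * k))) - bv n (Suc (Suc (2 * p))))"
    using Suc p by (simp add: skew_Suc(2)[of k] LK_linear X0_bv)
  then show ?case
    using p by (simp add: skew_Suc(1)[of "Suc k"]) (intro eq_vecI; simp)
qed

lemma X1_even_skew:
  "k < n \<Longrightarrow> X1 n *\<^sub>v even_skew (Suc k) =
    odd_skew (Suc k) + bv n (Suc (2 * (n - Suc k))) - ll \<cdot>\<^sub>v bv n (2 * n)"
proof (induction k)
  case 0
  then show ?case
    using X1_bv(2)[of 0] by (simp add: skew_0 skew_Suc LK_linear X1_bv) (intro eq_vecI; simp)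
next
  case (Suc k)
  then have p: "n - Suc k < n" by simp
  have "X1 n *\<^sub>v even_skew (Suc (Suc k)) =
      odd_skew (Suc k) + bv n (Suc (2 * (n - Suc k))) - ll \<cdot>\<^sub>v bv n (2 * n)
      + (bv n (Suc (2 * Suc k)) - bv n (Suc (2 * (n - Suc k))))"
    unfolding skew_Suc(1)[of "Suc k"] using Suc p
    by (simp add: LK_linear X1_bv(2)[of "Suc k"] X1_bv(2)[of "n - Suc k"] del: mult_Suc_right)
  then show ?case
    using p by (simp add: skew_Suc(2)[of "Suc k"]) (intro eq_vecI; simp)
qed

text \<open>The alternating word of length \<open>i\<close> ending in \<open>X\<^sub>0\<close>, applied to \<open>v\<^sub>2\<^sub>n\<close>, in closed form. It runs
  from \<open>v\<^sub>2\<^sub>n\<close> at \<open>i = 0\<close> to \<open>v\<^sub>0\<close> at \<open>i = 2n\<close>, each generator in turn moving one entry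
  to the next (\<open>X0_flip_col\<close>, \<open>X1_flip_col\<close>).\<close>
definition flip_col :: "nat \<Rightarrow> laurent vec" where
  "flip_col i =
     (if even i then bv n (2 * (n - i div 2)) + mm \<cdot>\<^sub>v odd_skew (i div 2)
      else bv n (Suc (2 * (n - Suc (i div 2)))) + mm \<cdot>\<^sub>v even_skew (Suc (i div 2)))"

lemma flip_col_simps:
  "flip_col (2 * k) = bv n (2 * (n - k)) + mm \<cdot>\<^sub>v odd_skew k"
  "flip_col (Suc (2 * k)) = bv n (Suc (2 * (n - Suc k))) + mm \<cdot>\<^sub>v even_skew (Suc k)"
  "flip_col (Suc (Suc (2 * k))) = bv n (2 * (n - Suc k)) + mm \<cdot>\<^sub>v odd_skew (Suc k)"
  by (simp_all add: flip_col_def)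

lemma flip_col_carrier [simp]: "flip_col i \<in> carrier_vec (Suc (2 * n))" "dim_vec (flip_col i) = Suc (2 * n)"
  by (simp_all add: flip_col_def)

lemma X0_flip_col:
  assumes "k < n"
  shows "X0 n *\<^sub>v flip_col (2 * k) = flip_col (Suc (2 * k))"
proof -
  have p: "n - k = Suc (n - Suc k)" "n - Suc k < n" using assms by auto
  show ?thesis
    unfolding flip_col_simps using assms p(2) 
    by (simp add: LK_linear X0_odd_skew p(1) X0_bv)
      (intro eq_vecI; simp add: ring_distribs)
qed

lemma X1_flip_col:
  assumes "k < n"
  shows "X1 n *\<^sub>v flip_col (Suc (2 * k)) = flip_col (Suc (Suc (2 * k)))"
  unfolding flip_col_simps using assms
  by (simp add: LK_linear X1_even_skew X1_bv) (intro eq_vecI; simp add: ring_distribs)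

lemma flip_col_0: "flip_col 0 = bv n (2 * n)"
  using flip_col_simps(1)[of 0] by (simp add: skew_0) (intro eq_vecI; simp)

lemma flip_col_last: "flip_col (2 * n) = bv n 0"
  by (simp add: flip_col_simps odd_skew_n) (intro eq_vecI; simp)

text \<open>The values of the two rank-one functionals that the skein relations ask for when a generator is
  applied twice. On the skew sums the contributions of \<open>j\<close> and \<open>2n - j\<close> cancel, except that
  \<open>j = 0\<close> leaves \<open>1 - \<tau>\<close> in the second case.\<close>
lemma gram_row_0_flip_col:
  assumes "k < n"
  shows "gram_row n 0 \<bullet> flip_col (2 * k) = 1"
proof -
  have "k \<le> n \<Longrightarrow> gram_row n 0 \<bullet> odd_skew k = 0" for k
    by (induction k) (simp_all add: skew_0 skew_Suc LK_linear gram_row_bv gram_simps)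
  moreover have "gram 0 (2 * (n - k)) = 1" using assms by (simp add: gram_def)
  ultimately show ?thesis
    using assms by (simp add: flip_col_simps LK_linear gram_row_bv)
qed

lemma gram_row_last_flip_col:
  assumes "k < n"
  shows "gram_row n (2 * n) \<bullet> flip_col (Suc (2 * k)) = ll_inv"
proof -
  have skew: "k < n \<Longrightarrow> gram_row n (2 * n) \<bullet> even_skew (Suc k) = 1 - tau" for k
  proof (induction k)
    case 0
    then show ?case
      using gram_simps(6)[of n 0] by (simp add: skew_0 skew_Suc LK_linear gram_row_bv gram_simps(6))
  next
    case (Suc k)
    then have "2 * Suc k < Suc (2 * n)" "n \<noteq> n - Suc k" by auto
    with Suc show ?case
      unfolding skew_Suc(1)[of "Suc k"]
      by (simp add: LK_linear gram_row_bv gram_simps(6) del: mult_Suc_right)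
  qed
  have "gram_row n (2 * n) \<bullet> flip_col (Suc (2 * k)) = ll + mm * (1 - tau)"
    using assms by (auto simp: flip_col_simps LK_linear gram_row_bv gram_simps skew)
  also have "\<dots> = ll_inv" by (simp add: tau_def ring_distribs)
  finally show ?thesis .
qed

text \<open>An operator that sends \<open>v\<^sub>0\<close> to \<open>l v\<^sub>2\<^sub>n\<close> and exchanges the roles of \<open>X\<^sub>0\<close> and \<open>X\<^sub>1\<close> must map \<open>v\<^sub>i\<close>,
  which is an alternating word applied to \<open>v\<^sub>0\<close>, to \<open>l\<close> times the exchanged word applied to
  \<open>v\<^sub>2\<^sub>n\<close>. Both sides of the braid relation will turn out to be this operator.\<close>
definition flip :: "laurent mat" where
  "flip = op_of n (\<lambda>i. ll \<cdot>\<^sub>v flip_col i)"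

lemma flip_carrier [simp]: "flip \<in> carrier_mat (Suc (2 * n)) (Suc (2 * n))"
  by (simp add: flip_def)

lemma flip_bv: "i < Suc (2 * n) \<Longrightarrow> flip *\<^sub>v bv n i = ll \<cdot>\<^sub>v flip_col i"
  by (simp add: flip_def op_of_bv)

text \<open>Where the generator climbs the ladder, the intertwining is the recursion for \<open>flip_col\<close>; where
  it descends, the generator on the other side is applied a second time and the skein relation
  takes over.\<close>
lemma flip_X1:
  assumes "x \<in> LK_space n"
  shows "flip *\<^sub>v (X1 n *\<^sub>v x) = X0 n *\<^sub>v (flip *\<^sub>v x)"
proof (rule LK_map_eqI[where x = x and f = "\<lambda>x. flip *\<^sub>v (X1 n *\<^sub>v x)" and g = "\<lambda>x. X0 n *\<^sub>v (flip *\<^sub>v x)"])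
  fix j assume "j < Suc (2 * n)"
  then show "flip *\<^sub>v (X1 n *\<^sub>v bv n j) = X0 n *\<^sub>v (flip *\<^sub>v bv n j)"
  proof (cases rule: LK_index_cases1)
    case (odd k)
    then have "X0 n *\<^sub>v flip_col (Suc (2 * k)) =
        flip_col (2 * k) - mm \<cdot>\<^sub>v flip_col (Suc (2 * k)) + lmono 1 1 \<cdot>\<^sub>v bv n 0"
      using X0_skein[of "flip_col (2 * k)"] by (simp add: X0_flip_col gram_row_0_flip_col)
    with odd show ?thesis
      by (simp add: X1_bv flip_bv LK_linear flip_col_last) (intro eq_vecI; simp add: ring_distribs)
  next
    case (even k)
    then show ?thesis by (simp add: X1_bv flip_bv LK_linear X0_flip_col)
  next
    case last
    then show ?thesis by (simp add: X1_bv flip_bv LK_linear flip_col_last X0_bv)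
  qed
qed (use assms in \<open>simp_all add: LK_linear\<close>)

lemma flip_X0:
  assumes "x \<in> LK_space n"
  shows "flip *\<^sub>v (X0 n *\<^sub>v x) = X1 n *\<^sub>v (flip *\<^sub>v x)"
proof (rule LK_map_eqI[where x = x and f = "\<lambda>x. flip *\<^sub>v (X0 n *\<^sub>v x)" and g = "\<lambda>x. X1 n *\<^sub>v (flip *\<^sub>v x)"])
  fix j assume "j < Suc (2 * n)"
  then show "flip *\<^sub>v (X0 n *\<^sub>v bv n j) = X1 n *\<^sub>v (flip *\<^sub>v bv n j)"
  proof (cases rule: LK_index_cases0)
    case (even k)
    then have "X1 n *\<^sub>v flip_col (Suc (Suc (2 * k))) =
        flip_col (Suc (2 * k)) - mm \<cdot>\<^sub>v flip_col (Suc (Suc (2 * k))) + mm \<cdot>\<^sub>v bv n (2 * n)"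
      using X1_skein[of "flip_col (Suc (2 * k))"] by (simp add: X1_flip_col gram_row_last_flip_col)
    with even show ?thesis
      by (simp add: X0_bv flip_bv LK_linear flip_col_0) (intro eq_vecI; simp add: ring_distribs)
  next
    case (odd k)
    then show ?thesis by (simp add: X0_bv flip_bv LK_linear X1_flip_col)
  next
    case zero
    then show ?thesis by (simp add: X0_bv flip_bv LK_linear flip_col_0 X1_bv)
  qed
qed (use assms in \<open>simp_all add: LK_linear\<close>)

abbreviation X01 :: "laurent vec \<Rightarrow> laurent vec" where "X01 x \<equiv> X0 n *\<^sub>v (X1 n *\<^sub>v x)"
abbreviation X10 :: "laurent vec \<Rightarrow> laurent vec" where "X10 x \<equiv> X1 n *\<^sub>v (X0 n *\<^sub>v x)"

lemma X01_funpow_carrier [simp]: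
  "x \<in> carrier_vec (Suc (2 * n)) \<Longrightarrow> (X01 ^^ k) x \<in> carrier_vec (Suc (2 * n))"
  "x \<in> carrier_vec (Suc (2 * n)) \<Longrightarrow> (X10 ^^ k) x \<in> carrier_vec (Suc (2 * n))"
  by (induction k) auto

lemma op_prod_alt_mult:
  assumes "A \<in> carrier_mat (Suc (2 * n)) (Suc (2 * n))" "B \<in> carrier_mat (Suc (2 * n)) (Suc (2 * n))"
    and "x \<in> LK_space n"
  shows "op_prod n (alt_begin A B (Suc (2 * k))) *\<^sub>v x = A *\<^sub>v ((\<lambda>y. B *\<^sub>v (A *\<^sub>v y)) ^^ k) x"
proof (induction k)
  case (Suc k)
  have "alt_begin A B (Suc (2 * Suc k)) = A # B # alt_begin A B (Suc (2 * k))" by simp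
  moreover have "op_prod n (alt_begin A B (Suc (2 * k))) \<in> carrier_mat (Suc (2 * n)) (Suc (2 * n))"
    using assms by (intro op_prod_alt_carrier)
  ultimately show ?case
    using assms Suc by (simp add: LK_mat_simps del: alt_begin.simps)
qed (use assms in \<open>simp add: LK_mat_simps\<close>)

lemma X0_X10_funpow: "X0 n *\<^sub>v (X10 ^^ k) x = (X01 ^^ k) (X0 n *\<^sub>v x)"
  by (induction k) simp_all

lemma X1_X01_funpow: "X1 n *\<^sub>v (X01 ^^ k) x = (X10 ^^ k) (X1 n *\<^sub>v x)"
  by (induction k) simp_all

lemma flip_funpow:
  assumes "x \<in> LK_space n"
  shows "flip *\<^sub>v (X10 ^^ k) x = (X01 ^^ k) (flip *\<^sub>v x)" "flip *\<^sub>v (X01 ^^ k) x = (X10 ^^ k) (flip *\<^sub>v x)"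
  using assms by (induction k) (simp_all add: flip_X0 flip_X1)

lemma X01_funpow_bv: "k \<le> n \<Longrightarrow> (X01 ^^ k) (bv n 0) = bv n (2 * k)"
  by (induction k) (simp_all add: X0_bv X1_bv)

definition word0 :: "laurent mat" where "word0 = op_prod n (alt_begin (X0 n) (X1 n) (2 * n + 1))"
definition word1 :: "laurent mat" where "word1 = op_prod n (alt_begin (X1 n) (X0 n) (2 * n + 1))"

lemma word_carrier [simp]:
  "word0 \<in> carrier_mat (Suc (2 * n)) (Suc (2 * n))" "word1 \<in> carrier_mat (Suc (2 * n)) (Suc (2 * n))"
  by (simp_all add: word0_def word1_def del: alt_begin.simps)

lemma word_mult:
  assumes "x \<in> LK_space n"
  shows "word0 *\<^sub>v x = X0 n *\<^sub>v (X10 ^^ n) x" "word1 *\<^sub>v x = X1 n *\<^sub>v (X01 ^^ n) x"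
  using assms op_prod_alt_mult[of "X0 n" "X1 n" x n] op_prod_alt_mult[of "X1 n" "X0 n" x n]
  by (simp_all add: word0_def word1_def del: alt_begin.simps)

text \<open>The two words are exchanged by \<open>flip\<close>, since they are obtained from each other by
  exchanging the letters.\<close>
lemma flip_word:
  assumes "x \<in> LK_space n"
  shows "flip *\<^sub>v (word0 *\<^sub>v x) = word1 *\<^sub>v (flip *\<^sub>v x)" "flip *\<^sub>v (word1 *\<^sub>v x) = word0 *\<^sub>v (flip *\<^sub>v x)"
  using assms by (simp_all add: word_mult flip_X0 flip_X1 flip_funpow)

text \<open>Here \<open>v\<^sub>2\<^sub>k = (X\<^sub>0X\<^sub>1)\<^sup>k v\<^sub>0\<close>, and the word is \<open>X\<^sub>1(X\<^sub>0X\<^sub>1)\<^sup>n\<close>. The powers commute, and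
  \<open>(X\<^sub>0X\<^sub>1)\<^sup>n v\<^sub>0 = v\<^sub>2\<^sub>n\<close> is \<open>flip\<close> of a multiple of \<open>v\<^sub>0\<close>. Moving \<open>flip\<close> to the front exchanges the
  remaining letters into \<open>X\<^sub>0(X\<^sub>1X\<^sub>0)\<^sup>k = (X\<^sub>0X\<^sub>1)\<^sup>k X\<^sub>0\<close>, whose last letter restores \<open>v\<^sub>0\<close>.\<close>
lemma word1_bv_even:
  assumes "k \<le> n"
  shows "word1 *\<^sub>v bv n (2 * k) = flip *\<^sub>v bv n (2 * k)"
proof -
  let ?u = "ll_inv \<cdot>\<^sub>v bv n 0"
  have last: "bv n (2 * n) = flip *\<^sub>v ?u"
    by (simp add: LK_linear flip_bv flip_col_0 smult_smult_assoc)
  have u: "X0 n *\<^sub>v ?u = bv n 0" by (simp add: LK_linear X0_bv smult_smult_assoc)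
  have "word1 *\<^sub>v bv n (2 * k) = X1 n *\<^sub>v (X01 ^^ n) ((X01 ^^ k) (bv n 0))"
    using assms by (simp add: word_mult X01_funpow_bv)
  also have "(X01 ^^ n) ((X01 ^^ k) (bv n 0)) = (X01 ^^ k) ((X01 ^^ n) (bv n 0))"
    by (rule funpow_funpow_commute)
  also have "X1 n *\<^sub>v \<dots> = X1 n *\<^sub>v (X01 ^^ k) (flip *\<^sub>v ?u)"
    by (simp add: X01_funpow_bv flip: last)
  also have "\<dots> = flip *\<^sub>v (X0 n *\<^sub>v (X10 ^^ k) ?u)"
    by (simp add: flip_X0 flip_funpow)
  also have "\<dots> = flip *\<^sub>v bv n (2 * k)"
    using assms by (simp add: X0_X10_funpow u X01_funpow_bv)
  finally show ?thesis .
qed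

lemma word0_bv_odd:
  assumes "k < n"
  shows "word0 *\<^sub>v bv n (Suc (2 * k)) = flip *\<^sub>v bv n (Suc (2 * k))"
proof -
  have "word0 *\<^sub>v bv n (Suc (2 * k)) = X0 n *\<^sub>v (word1 *\<^sub>v bv n (2 * k))"
    using assms by (simp add: word_mult X1_X01_funpow X1_bv)
  also have "\<dots> = flip *\<^sub>v (X1 n *\<^sub>v bv n (2 * k))"
    using assms by (simp add: word1_bv_even flip_X1)
  finally show ?thesis using assms by (simp add: X1_bv)
qed

text \<open>On the odd basis vectors this is known. On \<open>flip v\<^sub>2\<^sub>k\<close> it follows from
  \<open>word0 (flip v\<^sub>2\<^sub>k) = flip (word1 v\<^sub>2\<^sub>k) = flip (flip v\<^sub>2\<^sub>k)\<close>. Up to the factor \<open>l\<close>, this vector is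
  \<open>v\<^sub>2\<^sub>n\<^sub>-\<^sub>2\<^sub>k\<close> plus a combination of odd basis vectors, so the even basis vectors are reached too.\<close>
lemma word0_eq_flip: "word0 = flip"
proof (rule LK_mat_eqI)
  fix i assume "i < Suc (2 * n)"
  then show "word0 *\<^sub>v bv n i = flip *\<^sub>v bv n i"
  proof (cases rule: LK_index_cases)
    case (even j)
    define k where "k = n - j"
    have k: "k \<le> n" "n - k = j" using even by (auto simp: k_def)
    let ?d = "flip *\<^sub>v bv n (2 * k)"
    have d: "word0 *\<^sub>v ?d = flip *\<^sub>v ?d"
      using k by (simp add: word1_bv_even flip: flip_word)
    have skew: "word0 *\<^sub>v odd_skew k = flip *\<^sub>v odd_skew k" if "k \<le> n" for k
      using that by (induction k) (simp_all add: skew_0 skew_Suc LK_linear word0_bv_odd)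
    have "bv n (2 * j) = ll_inv \<cdot>\<^sub>v ?d - mm \<cdot>\<^sub>v odd_skew k"
      using k by (simp add: flip_bv flip_col_simps smult_smult_assoc) (intro eq_vecI; simp)
    with d skew[OF k(1)] show ?thesis
      using even by (simp add: LK_linear)
  qed (simp add: word0_bv_odd)
qed simp_all

lemma word1_eq_flip: "word1 = flip"
proof (rule LK_mat_eqI)
  fix i assume "i < Suc (2 * n)"
  then show "word1 *\<^sub>v bv n i = flip *\<^sub>v bv n i"
  proof (cases rule: LK_index_cases)
    case (odd j)
    define k where "k = n - Suc j"
    have k: "k < n" "n - Suc k = j" using odd by (auto simp: k_def)
    let ?d = "flip *\<^sub>v bv n (Suc (2 * k))"
    have d: "word1 *\<^sub>v ?d = flip *\<^sub>v ?d"
      using k by (simp add: word0_bv_odd flip: flip_word)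
    have skew: "word1 *\<^sub>v even_skew k = flip *\<^sub>v even_skew k" if "k \<le> Suc n" for k
      using that by (induction k) (simp_all add: skew_0 skew_Suc LK_linear word1_bv_even)
    have "bv n (Suc (2 * j)) = ll_inv \<cdot>\<^sub>v ?d - mm \<cdot>\<^sub>v even_skew (Suc k)"
      using k by (simp add: flip_bv flip_col_simps smult_smult_assoc) (intro eq_vecI; simp)
    with d skew[of "Suc k"] show ?thesis
      using odd k by (simp add: LK_linear)
  qed (simp add: word1_bv_even)
qed simp_all

lemma braid_relation:
  "op_prod n (alt_begin (X0 n) (X1 n) (2 * n + 1)) = op_prod n (alt_begin (X1 n) (X0 n) (2 * n + 1))"
  using word0_eq_flip word1_eq_flip unfolding word0_def word1_def by simp

section \<open>The action of the Artin group\<close>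

definition relators :: "(artin_gen word \<times> artin_gen word) set" where
  "relators = {(alt_begin (Sigma0, True) (Sigma1, True) (2 * n + 1),
     alt_begin (Sigma1, True) (Sigma0, True) (2 * n + 1))}"

definition letter_op :: "artin_gen \<times> bool \<Rightarrow> laurent mat" where
  "letter_op = (\<lambda>(s, e). if e then gen_op n s else op_inv n (gen_op n s))"

lemma letter_op_carrier [simp]: "letter_op x \<in> carrier_mat (Suc (2 * n)) (Suc (2 * n))"
  by (cases x; cases "fst x") (auto simp: letter_op_def op_inv_X)

lemma letter_op_cancel: "letter_op (s, e) * letter_op (s, \<not> e) = 1\<^sub>m (Suc (2 * n))"
  by (cases s; cases e) (auto simp: letter_op_def op_inv_X X0_inverse X1_inverse)

lemma word_op_eq: "word_op n w = op_prod n (map letter_op w)"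
  by (simp add: word_op_def letter_op_def)

lemma word_op_append: "word_op n (u @ v) = word_op n u * word_op n v"
  unfolding word_op_eq map_append by (intro op_prod_append) auto

lemma word_op_pres_eq: "pres_eq relators u v \<Longrightarrow> word_op n u = word_op n v"
proof (induction rule: pres_eq.induct)
  case (relation u v)
  then show ?case
    using braid_relation
    by (simp add: relators_def word_op_eq map_alt_begin letter_op_def del: alt_begin.simps)
next
  case (cancel s e)
  then show ?case
    by (simp add: word_op_eq letter_op_cancel LK_mat_simps)
qed (simp_all add: word_op_append)

text \<open>The braid relation makes the operator independent of the word, so the image of a class under
  \<open>word_op\<close> is a singleton and \<open>the_elem\<close> returns its element.\<close>
lemma LK_rep_class:
  "LK_rep n (Collect (pres_eq relators u)) = word_op n u"
proof -
  let ?C = "Collect (pres_eq relators u)"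
  have "word_op n w = word_op n u" if "w \<in> ?C" for w
    using that by (intro word_op_pres_eq[symmetric]) simp
  moreover have "u \<in> ?C" by (simp add: pres_eq.refl)
  ultimately have "word_op n ` ?C = {word_op n u}" by blast
  then show ?thesis by (simp add: LK_rep_def)
qed

lemma carrier_artin_I2: "carrier (artin_I2 n) = UNIV // {(u, v). pres_eq relators u v}"
  by (simp add: artin_I2_def presented_group_def relators_def)

lemma artin_invariant_iff_words:
  "artin_invariant n h \<longleftrightarrow>
    (\<forall>u. \<forall>v\<in>LK_space n. \<forall>w\<in>LK_space n. h (word_op n u *\<^sub>v v) (word_op n u *\<^sub>v w) = h v w)"
  unfolding artin_invariant_def carrier_artin_I2
  by (auto simp: quotient_def LK_rep_class)

text \<open>Invariance under an operator gives invariance under its inverse by substituting the images of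
  the inverse for the arguments, so the two generators suffice.\<close>
lemma artin_invariant_iff:
  "artin_invariant n h \<longleftrightarrow>
    (\<forall>A\<in>{X0 n, X1 n}. \<forall>v\<in>LK_space n. \<forall>w\<in>LK_space n. h (A *\<^sub>v v) (A *\<^sub>v w) = h v w)"
proof
  assume *: "artin_invariant n h"
  have "word_op n [(Sigma0, True)] = X0 n" "word_op n [(Sigma1, True)] = X1 n"
    by (simp_all add: word_op_eq letter_op_def LK_mat_simps)
  then have words: "\<exists>u. A = word_op n u" if "A \<in> {X0 n, X1 n}" for A
    using that by (elim insertE emptyE) (metis, metis)
  show "\<forall>A\<in>{X0 n, X1 n}. \<forall>v\<in>LK_space n. \<forall>w\<in>LK_space n. h (A *\<^sub>v v) (A *\<^sub>v w) = h v w"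
  proof (intro ballI)
    fix A v w assume "A \<in> {X0 n, X1 n}" "v \<in> LK_space n" "w \<in> LK_space n"
    with words[of A] * show "h (A *\<^sub>v v) (A *\<^sub>v w) = h v w"
      unfolding artin_invariant_iff_words by blast
  qed
next
  assume *: "\<forall>A\<in>{X0 n, X1 n}. \<forall>v\<in>LK_space n. \<forall>w\<in>LK_space n. h (A *\<^sub>v v) (A *\<^sub>v w) = h v w"
  have pos: "h (letter_op (s, True) *\<^sub>v v) (letter_op (s, True) *\<^sub>v w) = h v w"
    if "v \<in> LK_space n" "w \<in> LK_space n" for s v w
    using * that by (cases s) (auto simp: letter_op_def)
  have letter: "h (letter_op x *\<^sub>v v) (letter_op x *\<^sub>v w) = h v w"
    if "v \<in> LK_space n" "w \<in> LK_space n" for x v w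
  proof (cases x)
    case (Pair s e)
    show ?thesis
    proof (cases e)
      case False
      have "letter_op (s, True) *\<^sub>v (letter_op x *\<^sub>v y) = y" if "y \<in> LK_space n" for y
        using letter_op_cancel[of s True] Pair False that
        by (simp flip: LK_mat_simps(3))
      then show ?thesis
        using pos[of "letter_op x *\<^sub>v v" "letter_op x *\<^sub>v w" s] that by simp
    qed (use pos that Pair in simp)
  qed
  have "h (word_op n u *\<^sub>v v) (word_op n u *\<^sub>v w) = h v w"
    if "v \<in> LK_space n" "w \<in> LK_space n" for u v w
    using that
  proof (induction u)
    case (Cons x u)
    have "word_op n u \<in> carrier_mat (Suc (2 * n)) (Suc (2 * n))"
      unfolding word_op_eq by (intro op_prod_carrier) auto
    then show ?case
      using Cons letter by (simp add: word_op_eq LK_mat_simps)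
  qed (simp add: word_op_eq)
  then show "artin_invariant n h" by (simp add: artin_invariant_iff_words)
qed

lemma artin_invariant_LK_form: "artin_invariant n (LK_form n)"
  by (auto simp: artin_invariant_iff LK_form_X0 LK_form_X1)

section \<open>Uniqueness\<close>

text \<open>The eigenvalue equation at \<open>v\<^sub>2\<^sub>k\<^sub>+\<^sub>1\<close> and \<open>v\<^sub>2\<^sub>k\<^sub>+\<^sub>2\<close> expresses \<open>f(v\<^sub>2\<^sub>k\<^sub>+\<^sub>1)\<close> and \<open>f(v\<^sub>0)\<close> by
  \<open>f(v\<^sub>2\<^sub>k\<^sub>+\<^sub>2)\<close>, the latter as \<open>f(v\<^sub>0) = \<tau> f(v\<^sub>2\<^sub>k\<^sub>+\<^sub>2)\<close>. Cancelling \<open>\<tau>\<close>, all values at even positive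
  indices coincide. The normalisation at \<open>v\<^sub>2\<close>, where the row \<open>a\<^sub>0\<close> has the entry \<open>1\<close>, is
  what keeps the scalar in the ring; it needs \<open>n \<ge> 1\<close>.\<close>
lemma X0_eigenfunctional:
  assumes "n \<ge> 1"
    and add: "\<And>u v. u \<in> LK_space n \<Longrightarrow> v \<in> LK_space n \<Longrightarrow> f (u + v) = f u + f v"
    and smult: "\<And>c v. v \<in> LK_space n \<Longrightarrow> f (c \<cdot>\<^sub>v v) = c * f v"
    and eigen: "\<And>v. v \<in> LK_space n \<Longrightarrow> f (X0 n *\<^sub>v v) = ll * f v"
    and x: "x \<in> LK_space n"
  shows "f x = (gram_row n 0 \<bullet> x) * f (bv n 2)"
proof -
  have minus: "f (u - v) = f u - f v" if "u \<in> LK_space n" "v \<in> LK_space n" for u v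
  proof -
    have "u - v = u + (- 1) \<cdot>\<^sub>v v" using that by (intro eq_vecI) auto
    then show ?thesis using that by (simp add: add smult)
  qed
  have odd: "f (bv n (Suc (2 * k))) = ll_inv * f (bv n (Suc (Suc (2 * k))))" if "k < n" for k
  proof -
    have "f (bv n (Suc (Suc (2 * k)))) = ll * f (bv n (Suc (2 * k)))"
      using eigen[of "bv n (Suc (2 * k))"] that by (simp add: X0_bv)
    then show ?thesis by simp
  qed
  have zero: "f (bv n 0) = tau * f (bv n (Suc (Suc (2 * k))))" if "k < n" for k
  proof -
    let ?e = "f (bv n (Suc (Suc (2 * k))))"
    have "mm * f (bv n 0) - mm * ?e + ll_inv * ?e = ll * ?e"
      using eigen[of "bv n (Suc (Suc (2 * k)))"] that by (simp add: X0_bv add minus smult odd)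
    then have "mm * f (bv n 0) = mm * (tau * ?e)"
      by (simp add: tau_def ring_distribs algebra_simps)
    \<comment> \<open>\<open>m\<close> is a unit.\<close>
    then have "mm_inv * (mm * f (bv n 0)) = mm_inv * (mm * (tau * ?e))" by (rule arg_cong)
    then show ?thesis by simp
  qed
  have even: "f (bv n (Suc (Suc (2 * k)))) = f (bv n 2)" if "k < n" for k
  proof -
    have "tau * (f (bv n (Suc (Suc (2 * k)))) - f (bv n 2)) = 0"
      using zero[OF that] zero[of 0] assms(1) by (simp add: right_diff_distrib numeral_2_eq_2)
    from tau_mult_eq_zeroD[OF this] show ?thesis by simp
  qed
  have zero': "f (bv n 0) = tau * f (bv n 2)"
    using zero[of 0] assms(1) by (simp add: numeral_2_eq_2)
  show ?thesis
  proof (rule functional_eqI[where N = "2 * n + 1" and f = f and g = "\<lambda>x. (gram_row n 0 \<bullet> x) * f (bv n 2)"])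
    fix j assume "j < 2 * n + 1"
    then have "j < Suc (2 * n)" by simp
    then show "f (unit_vec (2 * n + 1) j) = (gram_row n 0 \<bullet> unit_vec (2 * n + 1) j) * f (bv n 2)"
      unfolding bv_def[symmetric]
      by (cases rule: LK_index_cases0)
        (simp_all add: even odd zero' gram_row_bv gram_simps)
  qed (use add smult x in \<open>simp_all add: LK_linear ring_distribs mult.assoc\<close>)
qed

text \<open>The scalar is \<open>h(v\<^sub>0, v\<^sub>2)\<close>. Once \<open>h(v\<^sub>0, -)\<close> is known, the invariance of both forms under the
  ladder generators determines \<open>h(v\<^sub>i, -)\<close> by induction on \<open>i\<close>.\<close>
lemma invariant_form_unique:
  assumes "n \<ge> 1" and h: "hermitian_form n h" and inv: "artin_invariant n h"
  shows "\<exists>c. \<forall>v\<in>LK_space n. \<forall>w\<in>LK_space n. h v w = c * LK_form n v w"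
proof -
  note herm = h[unfolded hermitian_form_def]
  have add_left: "h (u + v) w = h u w + h v w" and add_right: "h w (u + v) = h w u + h w v"
    if "u \<in> LK_space n" "v \<in> LK_space n" "w \<in> LK_space n" for u v w
    using herm that by blast+
  have smult: "h (f \<cdot>\<^sub>v v) (g \<cdot>\<^sub>v w) = f * bar_conj g * h v w"
    if "v \<in> LK_space n" "w \<in> LK_space n" for f g v w
    using herm that by blast
  have smult_left: "h (c \<cdot>\<^sub>v v) w = c * h v w" and smult_right: "h v (c \<cdot>\<^sub>v w) = bar_conj c * h v w"
    if "v \<in> LK_space n" "w \<in> LK_space n" for c v w
    using smult[OF that, of c 1] smult[OF that, of 1 c] by simp_all
  define c where "c = h (bv n 0) (bv n 2)"
  have base: "h (bv n 0) w = c * LK_form n (bv n 0) w" if w: "w \<in> LK_space n" for w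
  proof -
    have "bar_conj (h (bv n 0) w) = (gram_row n 0 \<bullet> w) * bar_conj (h (bv n 0) (bv n 2))"
    proof (rule X0_eigenfunctional[OF assms(1)])
      fix v assume v: "v \<in> LK_space n"
      have "ll * h (bv n 0) (X0 n *\<^sub>v v) = h (X0 n *\<^sub>v bv n 0) (X0 n *\<^sub>v v)"
        using v smult_left[of "bv n 0" "X0 n *\<^sub>v v" ll] by (simp add: X0_bv)
      also have "\<dots> = h (bv n 0) v"
        using inv v unfolding artin_invariant_iff by simp
      finally have "ll_inv * (ll * h (bv n 0) (X0 n *\<^sub>v v)) = ll_inv * h (bv n 0) v" by (rule arg_cong)
      then show "bar_conj (h (bv n 0) (X0 n *\<^sub>v v)) = ll * bar_conj (h (bv n 0) v)" by simp
    qed (use w in \<open>simp_all add: add_right smult_right\<close>)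
    then have "bar_conj (bar_conj (h (bv n 0) w)) =
        bar_conj ((gram_row n 0 \<bullet> w) * bar_conj (h (bv n 0) (bv n 2)))" by (rule arg_cong)
    with w show ?thesis by (simp add: c_def LK_form_bv mult.commute)
  qed
  have bv: "h (bv n i) w = c * LK_form n (bv n i) w" if "i < Suc (2 * n)" "w \<in> LK_space n" for i w
    using that
  proof (induction i arbitrary: w)
    case (Suc i)
    define y where "y = op_inv n (ladder i) *\<^sub>v w"
    have y: "y \<in> LK_space n" "ladder i *\<^sub>v y = w"
      using ladder_op_inv[of i] Suc.prems(2) by (simp_all add: y_def flip: LK_mat_simps(3))
    have step_inv: "k (ladder i *\<^sub>v bv n i) (ladder i *\<^sub>v y) = k (bv n i) y" if "artin_invariant n k" for k
      using that y(1) by (simp add: artin_invariant_iff ladder_def)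
    from step_inv[OF inv] step_inv[OF artin_invariant_LK_form] Suc.IH[OF _ y(1)] Suc.prems(1) y(2)
    show ?case by (simp add: ladder_bv)
  qed (simp add: base)
  have "h v w = c * LK_form n v w" if "v \<in> LK_space n" "w \<in> LK_space n" for v w
  proof (rule functional_eqI[where N = "2 * n + 1" and x = v
        and f = "\<lambda>v. h v w" and g = "\<lambda>v. c * LK_form n v w"])
    fix i assume "i < 2 * n + 1"
    then show "h (unit_vec (2 * n + 1) i) w = c * LK_form n (unit_vec (2 * n + 1) i) w"
      using bv[of i w] that by (simp add: bv_def)
  qed (use that in \<open>simp_all add: add_left smult_left LK_form_add_left LK_form_smult_left ring_distribs mult_ac\<close>)
  then show ?thesis by blast
qed

end

theorem theorem3p6:
  fixes n :: nat
  assumes "n \<ge> 1"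
  shows "hermitian_form n (LK_form n) \<and> artin_invariant n (LK_form n) \<and>
    (\<forall>h. hermitian_form n h \<and> artin_invariant n h \<longrightarrow>
       (\<exists>c. \<forall>v\<in>LK_space n. \<forall>w\<in>LK_space n. h v w = c * LK_form n v w))"
proof -
  interpret Lawrence_Krammer n .
  show ?thesis
    using hermitian_LK_form artin_invariant_LK_form invariant_form_unique[OF assms] by blast
qed

end
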